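(* Let $s\ge1$ and let $u_1,\dots,u_s\in\mathfrak{h}_C^0\cup\{y\}$ with $u_j\neq y$ for at least one $j$. Then \[ \sum_{i=1}^{s}Z_{\mathrm{cyc}}\big(u_{1}\otimes\cdots\otimes u_{i-1}\otimes(y\,\underline{\sqcup\!\sqcup}\, u_{i})\otimes u_{i+1}\otimes\cdots\otimes u_{s}\big) =\sum_{i=1}^{s}Z_{\mathrm{cyc}}\big(u_{1}\otimes\cdots\otimes u_{i}\otimes y\otimes u_{i+1}\otimes\cdots\otimes u_{s}\big), \] where $y\,\underline{\sqcup\!\sqcup}\, u_{i}=y\sqcup\!\sqcup u_{i}-yu_{i}-u_{i}y$.
   Context: Let $\mathfrak{h}=\mathbb{Q}\langle x,y\rangle$ (noncommutative polynomials), $\mathfrak{h}_C:=\mathfrak{h}x\oplus\mathfrak{h}y$, $\mathfrak{h}^0:=\mathbb{Q}\oplus y\mathfrak{h}x$, $\mathfrak{h}^1:=\mathbb{Q}\oplus y\mathfrak{h}$, $\mathfrak{h}_C^0:=\mathfrak{h}^0\cap\mathfrak{h}_C$, $\mathfrak{h}_C^1:=\mathfrak{h}^1\cap\mathfrak{h}_C$, and $z_k:=yx^{k-1}$ for $k\ge1$. The shuffle product $\sqcup\!\sqcup$ on $\mathfrak{h}$ is the $\mathbb{Q}$-bilinear product with $1\sqcup\!\sqcup w=w\sqcup\!\sqcup 1=w$ and $uw\sqcup\!\sqcup u'w'=u(w\sqcup\!\sqcup u'w')+u'(uw\sqcup\!\sqcup w')$ for $u,u'\in\{x,y\}$, $w,w'\in\mathfrak{h}$.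 The inner shuffle product $\underline{\sqcup\!\sqcup}:\mathfrak{h}\times\mathfrak{h}_C\to\mathfrak{h}_C$ is the bilinear map with $w\,\underline{\sqcup\!\sqcup}\, x=w\,\underline{\sqcup\!\sqcup}\, y=0$ and $w\,\underline{\sqcup\!\sqcup}\, uw'u'=u(w\sqcup\!\sqcup w')u'$ for $u,u'\in\{x,y\}$, $w,w'\in\mathfrak{h}$. An index $(k_1,\dots,k_r)$ of positive integers is admissible if $k_r\ge2$. A multi-index $\Bbbk=[(k_{1,1},\dots,k_{1,r_{1}}),\dots,(k_{s,1},\dots,k_{s,r_{s}})]$ is an admissible cyclic index if each block is admissible or equal to $(1)$ and at least one block is not $(1)$; then $\zeta_{\mathrm{cyc}}(\Bbbk):=\sum_{(n_{i,j})\in S}\prod_{i,j}n_{i,j}^{-k_{i,j}}$ with $S=\{(n_{1,1},\dots,n_{s,r_s})\in\mathbb{Z}_{\ge1}^{r_1+\cdots+r_s}\mid n_{1,1}<\cdots<n_{1,r_{1}}\geq n_{2,1}<\cdots<n_{2,r_{2}}\geq\cdots\geq n_{s,1}<\cdots<n_{s,r_{s}}\geq n_{1,1}\}$. Let $\mathfrak{h}^{\mathrm{cyc}}\subset\bigoplus_{s\ge1}\mathfrak{h}^{\otimes s}$ be the subspace spanned by all $u_1\otimes\cdots\otimes u_s$ with $u_i\in\mathfrak{h}_C^0\cup\{y\}$ and some $u_j\ne y$, and let $Z_{\mathrm{cyc}}:\mathfrak{h}^{\mathrm{cyc}}\to\mathbb{R}$ be the $\mathbb{Q}$-linear map with $Z_{\mathrm{cyc}}(z_{k_{1,1}}\cdots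 z_{k_{1,r_{1}}}\otimes\cdots\otimes z_{k_{s,1}}\cdots z_{k_{s,r_{s}}})=\zeta_{\mathrm{cyc}}([(k_{1,1},\dots,k_{1,r_{1}}),\dots,(k_{s,1},\dots,k_{s,r_{s}})])$ (extended multilinearly). *)

theory Defs
  imports "HOL-Analysis.Analysis" "HOL-Library.Poly_Mapping"
begin

text \<open>
  The noncommutative polynomial ring in two letters over the rationals is the monoid algebra of the
  free monoid of words; words are a separate type because lists are not an instance of
  \<^class>\<open>monoid_add\<close>. Multiplication in \<open>ncpoly\<close> is linearly extended concatenation.
\<close>

datatype letter = Lx | Ly

datatype ncword = Word (letters: "letter list")

instantiation ncword :: monoid_add
begin

definition zero_ncword :: ncword where
  "0 = Word []"

definition plus_ncword :: "ncword \<Rightarrow> ncword \<Rightarrow> ncword" where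
  "u + v = Word (letters u @ letters v)"

instance
  by standard (simp_all add: zero_ncword_def plus_ncword_def)

end

type_synonym ncpoly = "ncword \<Rightarrow>\<^sub>0 rat"

definition scalar :: "rat \<Rightarrow> ncpoly" where
  "scalar c = Poly_Mapping.single 0 c"

definition mon :: "letter list \<Rightarrow> ncpoly" where
  "mon w = Poly_Mapping.single (Word w) 1"

definition ncx :: ncpoly where
  "ncx = mon [Lx]"

definition ncy :: ncpoly where
  "ncy = mon [Ly]"

definition hC :: "ncpoly set" where
  "hC = {a * ncx + b * ncy | a b. True}"

definition h0 :: "ncpoly set" where
  "h0 = {scalar c + ncy * a * ncx | c a. True}"

definition hC0 :: "ncpoly set" where
  "hC0 = h0 \<inter> hC"


definition bilinear_ext :: "(letter list \<Rightarrow> letter list \<Rightarrow> ncpoly) \<Rightarrow> ncpoly \<Rightarrow> ncpoly \<Rightarrow> ncpoly" where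
  "bilinear_ext f p q =
     (\<Sum>u\<in>Poly_Mapping.keys p. \<Sum>v\<in>Poly_Mapping.keys q.
        scalar (Poly_Mapping.lookup p u * Poly_Mapping.lookup q v) * f (letters u) (letters v))"

fun shuffle_word :: "letter list \<Rightarrow> letter list \<Rightarrow> ncpoly" where
  "shuffle_word [] w = mon w"
| "shuffle_word w [] = mon w"
| "shuffle_word (a # u) (b # v) =
     mon [a] * shuffle_word u (b # v) + mon [b] * shuffle_word (a # u) v"

definition shuffle :: "ncpoly \<Rightarrow> ncpoly \<Rightarrow> ncpoly" where
  "shuffle = bilinear_ext shuffle_word"

text \<open>
  The inner shuffle product is only meaningful when its second argument lies in \<open>hC\<close>, that is, has no
  constant term; the empty word, which does not occur there, is sent to 0.
\<close>

definition inner_shuffle_word :: "letter list \<Rightarrow> letter list \<Rightarrow> ncpoly" where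
  "inner_shuffle_word w v =
     (if length v \<ge> 2 then mon [hd v] * shuffle_word w (butlast (tl v)) * mon [last v] else 0)"

definition inner_shuffle :: "ncpoly \<Rightarrow> ncpoly \<Rightarrow> ncpoly" where
  "inner_shuffle = bilinear_ext inner_shuffle_word"


text \<open>
  Multi-indices and summation variables are lists of blocks, with positions counted from 0.
\<close>

definition cyc_domain :: "nat list list \<Rightarrow> nat list list set" where
  "cyc_domain kk = {nn. map length nn = map length kk
     \<and> (\<forall>b\<in>set nn. (\<forall>n\<in>set b. n \<ge> 1) \<and> sorted_wrt (<) b)
     \<and> (\<forall>i<length nn. last (nn ! i) \<ge> hd (nn ! (Suc i mod length nn)))}"

definition zeta_cyc :: "nat list list \<Rightarrow> real" where
  "zeta_cyc kk = (\<Sum>\<^sub>\<infinity>nn\<in>cyc_domain kk.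
     \<Prod>i<length kk. \<Prod>j<length (kk ! i). 1 / real (nn ! i ! j) ^ (kk ! i ! j))"

definition zword :: "nat list \<Rightarrow> letter list" where
  "zword ks = concat (map (\<lambda>k. Ly # replicate (k - 1) Lx) ks)"

text \<open>
  Inverse of \<open>zword\<close> on indices of positive integers; the value on words starting with \<open>Lx\<close> is
  immaterial.
\<close>

function zindex :: "letter list \<Rightarrow> nat list" where
  "zindex [] = []"
| "zindex (Lx # w) = zindex w"
| "zindex (Ly # w) =
     Suc (length (takeWhile (\<lambda>a. a = Lx) w)) # zindex (dropWhile (\<lambda>a. a = Lx) w)"
  by pat_completeness auto
termination
  by (relation "Wellfounded.measure length") (auto simp: less_Suc_eq_le length_dropWhile_le)

text \<open>
  The direct sum of the tensor powers of \<open>ncpoly\<close> has the tuples of words as a basis, so it is the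
  space of finitely supported rational functions on lists of words.
\<close>

type_synonym nctensor = "ncword list \<Rightarrow>\<^sub>0 rat"

definition tensor :: "ncpoly list \<Rightarrow> nctensor" where
  "tensor us = (\<Sum>ws\<in>listset (map Poly_Mapping.keys us).
     Poly_Mapping.single ws (\<Prod>i<length us. Poly_Mapping.lookup (us ! i) (ws ! i)))"

text \<open>
  The map is linear on the whole tensor space; only its values on the span of the tensors whose
  factors lie in \<open>hC0 \<union> {ncy}\<close>, not all equal to \<open>ncy\<close>, are meaningful.
\<close>

definition Z_cyc :: "nctensor \<Rightarrow> real" where
  "Z_cyc T = (\<Sum>ws\<in>Poly_Mapping.keys T.
     of_rat (Poly_Mapping.lookup T ws) * zeta_cyc (map (\<lambda>w. zindex (letters w)) ws))"


lemma scalar_simps [simp]: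
  "scalar 0 = 0" "scalar 1 = 1" "scalar (a + b) = scalar a + scalar b"
  "scalar (a * b) = scalar a * scalar b"
  by (simp_all add: scalar_def single_add mult_single)

lemma mon_Nil: "mon [] = 1"
  by (simp add: mon_def flip: zero_ncword_def)

lemma mon_mult: "mon u * mon v = mon (u @ v)"
  by (simp add: mon_def mult_single plus_ncword_def)

lemma single_eq_scalar_mon: "Poly_Mapping.single w c = scalar c * mon (letters w)"
  by (simp add: scalar_def mon_def mult_single)

lemma ncpoly_induct [case_names mon add]:
  fixes p :: ncpoly
  assumes "\<And>c w. P (scalar c * mon w)" and "\<And>p q. P p \<Longrightarrow> P q \<Longrightarrow> P (p + q)"
  shows "P p"
proof -
  have "P (\<Sum>k\<in>A. Poly_Mapping.single k (Poly_Mapping.lookup p k))" if "finite A" for A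
    using that
  proof induction
    case empty
    show ?case using assms(1)[of 0 "[]"] by simp
  next
    case (insert k A)
    then show ?case using assms by (simp add: single_eq_scalar_mon)
  qed
  moreover have "(\<Sum>k\<in>Poly_Mapping.keys p. Poly_Mapping.single k (Poly_Mapping.lookup p k)) = p"
    by (rule poly_mapping_eqI) (simp add: lookup_sum lookup_single when_def in_keys_iff)
  ultimately show ?thesis by (metis finite_keys)
qed

lemma scalar_commute: "scalar c * p = p * scalar c"
proof (induction p rule: ncpoly_induct)
  case (mon d w)
  then show ?case by (simp add: scalar_def mon_def mult_single mult.commute)
qed (simp add: distrib_left distrib_right)

lemma bilinear_ext_add_left: "bilinear_ext f (p + p') q = bilinear_ext f p q + bilinear_ext f p' q"
  unfolding bilinear_ext_def
  by (rule setsum_keys_plus_distrib) (simp_all add: algebra_simps sum.distrib)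

lemma bilinear_ext_add_right: "bilinear_ext f p (q + q') = bilinear_ext f p q + bilinear_ext f p q'"
  unfolding bilinear_ext_def sum.distrib[symmetric]
  by (rule sum.cong[OF refl], rule setsum_keys_plus_distrib) (simp_all add: algebra_simps)

lemma bilinear_ext_mon:
  "bilinear_ext f (scalar c * mon u) (scalar d * mon v) = scalar (c * d) * f u v"
  by (simp add: bilinear_ext_def scalar_def mon_def mult_single)

lemma shuffle_one: "shuffle 1 w = w" "shuffle w 1 = w"
proof -
  have *: "shuffle (scalar 1 * mon []) w = w"
    by (induction w rule: ncpoly_induct)
      (simp_all only: shuffle_def bilinear_ext_mon bilinear_ext_add_right, simp)
  have **: "shuffle_word w [] = mon w" for w by (cases w) auto
  have "shuffle w (scalar 1 * mon []) = w"
    by (induction w rule: ncpoly_induct)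
      (simp_all only: shuffle_def bilinear_ext_mon bilinear_ext_add_left, simp add: **)
  with * show "shuffle 1 w = w" "shuffle w 1 = w" by (simp_all add: mon_Nil)
qed

lemma scalar_mon_mult: "mon w * (scalar c * q) = scalar c * (mon w * q)"
  by (metis mult.assoc scalar_commute)

lemma shuffle_rec:
  "shuffle (mon [a] * w) (mon [b] * w') =
     mon [a] * shuffle w (mon [b] * w') + mon [b] * shuffle (mon [a] * w) w'"
proof (induction w rule: ncpoly_induct)
  case (mon c u)
  show ?case
  proof (induction w' rule: ncpoly_induct)
    case (mon d v)
    show ?case
      by (simp only: shuffle_def scalar_mon_mult mon_mult bilinear_ext_mon)
        (simp add: distrib_left mult.assoc scalar_mon_mult)
  next
    case (add p q)
    then show ?case
      by (simp add: shuffle_def distrib_left bilinear_ext_add_right)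
  qed
next
  case (add p q)
  then show ?case
    by (simp add: shuffle_def distrib_left bilinear_ext_add_left)
qed

lemma inner_shuffle_letter: "inner_shuffle w (mon [a]) = 0"
proof -
  have "inner_shuffle w (scalar 1 * mon [a]) = 0"
    by (induction w rule: ncpoly_induct)
      (simp_all only: inner_shuffle_def bilinear_ext_mon bilinear_ext_add_left,
        simp_all add: inner_shuffle_word_def)
  then show ?thesis by simp
qed

lemma inner_shuffle_rec:
  "inner_shuffle w (mon [a] * w' * mon [b]) = mon [a] * shuffle w w' * mon [b]"
proof (induction w rule: ncpoly_induct)
  case (mon c u)
  show ?case
  proof (induction w' rule: ncpoly_induct)
    case (mon d v)
    show ?case
      by (simp only: shuffle_def inner_shuffle_def scalar_mon_mult mon_mult mult.assoc bilinear_ext_mon)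
        (simp add: inner_shuffle_word_def mult.assoc scalar_mon_mult)
  next
    case (add p q)
    then show ?case
      by (simp add: shuffle_def inner_shuffle_def distrib_left distrib_right bilinear_ext_add_right)
  qed
next
  case (add p q)
  then show ?case
    by (simp add: shuffle_def inner_shuffle_def distrib_left distrib_right bilinear_ext_add_left)
qed

lemma zindex_zword: "\<forall>k\<in>set ks. k \<ge> 1 \<Longrightarrow> zindex (zword ks) = ks"
proof (induction ks)
  case (Cons k ks)
  have "takeWhile (\<lambda>a. a = Lx) (replicate n Lx @ zword ks) = replicate n Lx
      \<and> dropWhile (\<lambda>a. a = Lx) (replicate n Lx @ zword ks) = zword ks" for n
    by (induction n) (cases ks; simp add: zword_def)+
  moreover have "zword (k # ks) = Ly # replicate (k - 1) Lx @ zword ks"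
    by (simp add: zword_def)
  ultimately show ?case using Cons by simp
qed (simp add: zword_def)

lemma listset_keys:
  "ws \<in> listset (map Poly_Mapping.keys us) \<longleftrightarrow>
     length ws = length us \<and> (\<forall>i<length us. Poly_Mapping.lookup (us ! i) (ws ! i) \<noteq> 0)"
proof (induction us arbitrary: ws)
  case (Cons u us)
  show ?case
    by (cases ws) (auto simp: set_Cons_def Cons.IH in_keys_iff less_Suc_eq_0_disj)
qed simp

lemma finite_listset_keys: "finite (listset (map Poly_Mapping.keys us))"
proof (induction us)
  case (Cons u us)
  have "listset (map Poly_Mapping.keys (u # us)) =
      (\<lambda>(w, ws). w # ws) ` (Poly_Mapping.keys u \<times> listset (map Poly_Mapping.keys us))"
    by (auto simp: set_Cons_def image_iff)
  with Cons show ?case by simp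
qed simp

lemma lookup_tensor:
  "Poly_Mapping.lookup (tensor us) ws =
     (if length ws = length us then \<Prod>i<length us. Poly_Mapping.lookup (us ! i) (ws ! i) else 0)"
proof -
  have "Poly_Mapping.lookup (tensor us) ws =
      (if ws \<in> listset (map Poly_Mapping.keys us)
       then \<Prod>i<length us. Poly_Mapping.lookup (us ! i) (ws ! i) else 0)"
    by (simp add: tensor_def lookup_sum lookup_single when_def finite_listset_keys sum.delta)
  then show ?thesis by (auto simp: listset_keys)
qed

lemma Z_cyc_add: "Z_cyc (S + T) = Z_cyc S + Z_cyc T"
  unfolding Z_cyc_def
  by (rule setsum_keys_plus_distrib) (simp_all add: of_rat_add algebra_simps)

lemma tensor_mon: "tensor (map mon ws) = Poly_Mapping.single (map Word ws) 1"
proof (rule poly_mapping_eqI)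
  fix vs
  show "Poly_Mapping.lookup (tensor (map mon ws)) vs =
      Poly_Mapping.lookup (Poly_Mapping.single (map Word ws) 1) vs"
    by (auto simp: lookup_tensor lookup_single when_def mon_def list_eq_iff_nth_eq)
qed

lemma Z_cyc_zword:
  assumes "\<forall>ks\<in>set kk. \<forall>k\<in>set ks. k \<ge> 1"
  shows "Z_cyc (tensor (map (\<lambda>ks. mon (zword ks)) kk)) = zeta_cyc kk"
proof -
  have "tensor (map (\<lambda>ks. mon (zword ks)) kk) = Poly_Mapping.single (map Word (map zword kk)) 1"
    using tensor_mon[of "map zword kk"] by (simp add: o_def)
  moreover have "map (\<lambda>ks. zindex (zword ks)) kk = kk"
    using assms by (simp add: map_idI zindex_zword)
  ultimately show ?thesis by (simp add: Z_cyc_def o_def)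
qed

end

theory Submission
  imports Defs "HOL-Library.Function_Algebras" "HOL-Real_Asymp.Real_Asymp"
begin

text \<open>
  Truncate all summation variables to \<open>{1..N}\<close>. The truncated cyclic zeta value is then the trace of
  a product of \<open>N \<times> N\<close> matrices: \<open>x\<close> acts as the diagonal matrix \<open>X\<close> with entries \<open>1 / n\<close>, the letter
  \<open>y\<close> inside a block as \<open>S p q = [p < q] / q\<close>, and the first \<open>y\<close> of a block as \<open>T p q = [q \<le> p] / q\<close>.
  For \<open>U p q = [p < q] / (q - p)\<close> partial fractions give \<open>[X, U] = X S\<close>, \<open>[S, U] = S S\<close> and
  \<open>[T, U] = T S - S T - T T + H\<close> with \<open>H p q = (1 / (N - p + 1) + \<dots> + 1 / N) / q\<close>. Hence for a word \<open>w\<close>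
  with matrix \<open>W\<close>, the commutator \<open>[W, U]\<close> is the sum of the matrices of all interior insertions of \<open>y\<close>
  into \<open>w\<close>, plus the commutator \<open>[W, S]\<close>, minus the matrix \<open>T W\<close> (a block \<open>y\<close> inserted before \<open>w\<close>),
  plus a term containing \<open>H\<close>. Summing over the factors of a cyclic product, the trace kills both families
  of commutators, and the \<open>H\<close> terms vanish as \<open>N\<close> tends to infinity.
\<close>

subsection \<open>Truncated kernels\<close>

text \<open>Insertions of \<open>Ly\<close> right after each letter, one entry per letter and with
  multiplicity. The place in front of the word is left out, because commuting U past a letter
  produces an S only on the right of that letter.\<close>

fun ins :: "letter list \<Rightarrow> letter list list" where
  "ins [] = []"
| "ins (l # w) = (l # Ly # w) # map (Cons l) (ins w)"

lemma ins_snoc: "ins (w @ [l]) = map (\<lambda>v. v @ [l]) (ins w) @ [w @ [l, Ly]]"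
  by (induction w) simp_all

type_synonym kern = "nat \<Rightarrow> nat \<Rightarrow> real"

context
  fixes N :: nat
begin

definition kmul :: "kern \<Rightarrow> kern \<Rightarrow> kern" (infixl "\<odot>" 70) where
  "A \<odot> B = (\<lambda>p q. \<Sum>n=1..N. A p n * B n q)"

text \<open>Kernels are total functions on the naturals, so this is a two-sided unit only for
  kernels that vanish outside \<open>{1..N}\<close>; \<open>ksupp\<close> records that
  condition.\<close>

definition kid :: kern where
  "kid p q = of_bool (p = q \<and> p \<in> {1..N})"

definition ktrace :: "kern \<Rightarrow> real" where
  "ktrace A = (\<Sum>p=1..N. A p p)"

definition ksupp :: "kern \<Rightarrow> bool" where
  "ksupp A \<longleftrightarrow> (\<forall>p q. A p q \<noteq> 0 \<longrightarrow> p \<in> {1..N} \<and> q \<in> {1..N})"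

definition kX :: kern where
  "kX p q = of_bool (p = q \<and> p \<in> {1..N}) / real p"

text \<open>\<open>kstep False\<close> is the matrix S (strict ascent inside a block),
  \<open>kstep True\<close> is the matrix T (weak descent into a new block).\<close>

definition kstep :: "bool \<Rightarrow> kern" where
  "kstep f p q = of_bool (p \<in> {1..N} \<and> q \<in> {1..N} \<and> (if f then q \<le> p else p < q)) / real q"

definition kU :: kern where
  "kU p q = of_bool (p \<in> {1..N} \<and> q \<in> {1..N} \<and> p < q) / (real q - real p)"

text \<open>The difference of the harmonic numbers of N and N - p; it measures what the cut at N
  costs.\<close>

definition htail :: "nat \<Rightarrow> real" where
  "htail p = (\<Sum>n=N-p+1..N. 1 / real n)"

definition kH :: kern where
  "kH p q = of_bool (p \<in> {1..N} \<and> q \<in> {1..N}) * htail p / real q"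

section \<open>Algebra of kernels and the trace\<close>

lemma kmul_assoc: "A \<odot> B \<odot> C = A \<odot> (B \<odot> C)"
  unfolding kmul_def sum_distrib_left sum_distrib_right
  by (intro ext, subst sum.swap) (simp add: mult.assoc)

lemma kmul_add_left: "(A + B) \<odot> C = A \<odot> C + B \<odot> C"
  by (intro ext) (simp add: kmul_def distrib_right sum.distrib)

lemma kmul_add_right: "A \<odot> (B + C) = A \<odot> B + A \<odot> C"
  by (intro ext) (simp add: kmul_def distrib_left sum.distrib)

lemma kmul_diff_left: "(A - B) \<odot> C = A \<odot> C - B \<odot> C"
  by (intro ext) (simp add: kmul_def left_diff_distrib sum_subtractf)

lemma kmul_diff_right: "A \<odot> (B - C) = A \<odot> B - A \<odot> C"
  by (intro ext) (simp add: kmul_def right_diff_distrib sum_subtractf)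

lemma kmul_zero [simp]: "0 \<odot> A = 0" "A \<odot> 0 = 0"
  by (simp_all add: kmul_def fun_eq_iff)

lemma kmul_sum_list_left: "(\<Sum>x\<leftarrow>xs. f x) \<odot> B = (\<Sum>x\<leftarrow>xs. f x \<odot> B)"
  by (induction xs) (simp_all only: list.map sum_list.Nil sum_list.Cons kmul_add_left kmul_zero)

lemma kmul_sum_list_right: "B \<odot> (\<Sum>x\<leftarrow>xs. f x) = (\<Sum>x\<leftarrow>xs. B \<odot> f x)"
  by (induction xs) (simp_all only: list.map sum_list.Nil sum_list.Cons kmul_add_right kmul_zero)

lemma ktrace_add: "ktrace (A + B) = ktrace A + ktrace B"
  by (simp add: ktrace_def sum.distrib)

lemma ktrace_diff: "ktrace (A - B) = ktrace A - ktrace B"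
  by (simp add: ktrace_def sum_subtractf)

lemma ktrace_zero: "ktrace 0 = 0"
  by (simp add: ktrace_def)

lemma ktrace_sum_list: "ktrace (\<Sum>x\<leftarrow>xs. f x) = (\<Sum>x\<leftarrow>xs. ktrace (f x))"
  by (induction xs) (simp_all only: list.map sum_list.Nil sum_list.Cons ktrace_add ktrace_zero)

lemma ktrace_sum: "ktrace (\<Sum>x\<in>S. f x) = (\<Sum>x\<in>S. ktrace (f x))"
  by (induction S rule: infinite_finite_induct)
    (simp_all add: ktrace_add ktrace_zero del: plus_fun_apply zero_fun_apply)

lemma ktrace_commute: "ktrace (A \<odot> B) = ktrace (B \<odot> A)"
  unfolding ktrace_def kmul_def by (subst sum.swap) (simp add: mult.commute)

lemma ksupp_base [simp]: "ksupp kid" "ksupp kX" "ksupp (kstep f)" "ksupp kU"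
  by (auto simp: ksupp_def kid_def kX_def kstep_def kU_def)

lemma ksupp_kmul [simp]: "ksupp A \<Longrightarrow> ksupp B \<Longrightarrow> ksupp (A \<odot> B)"
  unfolding ksupp_def kmul_def by (metis (no_types, lifting) mult_eq_0_iff sum.neutral)

lemma kid_left: "ksupp A \<Longrightarrow> kid \<odot> A = A"
proof (intro ext)
  fix p q
  assume A: "ksupp A"
  have "(kid \<odot> A) p q = (\<Sum>n=1..N. if n = p then A p q else 0)"
    unfolding kmul_def by (rule sum.cong) (auto simp: kid_def)
  also have "\<dots> = A p q" using A by (auto simp: ksupp_def)
  finally show "(kid \<odot> A) p q = A p q" .
qed

lemma kid_right: "ksupp A \<Longrightarrow> A \<odot> kid = A"
proof (intro ext)
  fix p q
  assume A: "ksupp A"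
  have "(A \<odot> kid) p q = (\<Sum>n=1..N. if n = q then A p q else 0)"
    unfolding kmul_def by (rule sum.cong) (auto simp: kid_def)
  also have "\<dots> = A p q" using A by (auto simp: ksupp_def)
  finally show "(A \<odot> kid) p q = A p q" .
qed

lemma kX_right: "(A \<odot> kX) p q = (if q \<in> {1..N} then A p q / real q else 0)"
proof -
  have "(A \<odot> kX) p q = (\<Sum>n=1..N. if n = q then A p q / real q else 0)"
    unfolding kmul_def by (rule sum.cong) (auto simp: kX_def)
  then show ?thesis by simp
qed

lemma kX_left: "(kX \<odot> A) p q = (if p \<in> {1..N} then A p q / real p else 0)"
proof -
  have "(kX \<odot> A) p q = (\<Sum>n=1..N. if n = p then A p q / real p else 0)"
    unfolding kmul_def by (rule sum.cong) (auto simp: kX_def)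
  then show ?thesis by simp
qed

section \<open>Commutators with U\<close>

lemma comm_X_U: "kX \<odot> kU - kU \<odot> kX = kX \<odot> kstep False"
  \<comment> \<open>For p < q the entry is (1/p - 1/q) / (q - p) = 1 / (p q).\<close>
  by (intro ext) (auto simp: kX_left kX_right kU_def kstep_def field_simps)

lemma sum_reflect_open:
  fixes p q :: nat
  shows "(\<Sum>n\<in>{p<..<q}. 1 / (real q - real n)) = (\<Sum>n\<in>{p<..<q}. 1 / (real n - real p))"
  by (rule sum.reindex_bij_witness[of _ "\<lambda>n. p + q - n" "\<lambda>n. p + q - n"]) (auto simp: of_nat_diff)

lemma kstep_False_left:
  assumes "p \<in> {1..N}" "q \<in> {1..N}"
  shows "(kstep False \<odot> kU) p q = (\<Sum>n\<in>{p<..<q}. 1 / real n * (1 / (real q - real n)))"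
    and "(kU \<odot> kstep False) p q = (\<Sum>n\<in>{p<..<q}. 1 / (real n - real p) * (1 / real q))"
    and "(kstep False \<odot> kstep False) p q = (\<Sum>n\<in>{p<..<q}. 1 / real n * (1 / real q))"
  unfolding kmul_def
  by (rule sum.mono_neutral_cong_right; use assms in \<open>auto simp: kstep_def kU_def\<close>)+

text \<open>Partial fractions: 1 / (n (q - n)) = (1/n + 1/(q - n)) / q. The first summand gives S S;
  reflecting the interval p < n < q turns the second into the entry of U S.\<close>

lemma comm_step_U: "kstep False \<odot> kU - kU \<odot> kstep False = kstep False \<odot> kstep False"
proof (intro ext)
  fix p q
  show "(kstep False \<odot> kU - kU \<odot> kstep False) p q = (kstep False \<odot> kstep False) p q"
  proof (cases "p \<in> {1..N} \<and> q \<in> {1..N}")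
    case True
    have "(\<Sum>n\<in>{p<..<q}. 1 / real n * (1 / (real q - real n)))
        = (\<Sum>n\<in>{p<..<q}. 1 / real n * (1 / real q) + (1 / (real q - real n)) * (1 / real q))"
      using True by (intro sum.cong) (auto simp: field_simps)
    also have "\<dots> = (\<Sum>n\<in>{p<..<q}. 1 / real n * (1 / real q))
        + (\<Sum>n\<in>{p<..<q}. 1 / (real n - real p)) * (1 / real q)"
      by (simp only: sum.distrib sum_distrib_right[symmetric] sum_reflect_open)
    finally show ?thesis using True by (simp only: kstep_False_left sum_distrib_right minus_apply)
  next
    case False
    then show ?thesis by (auto simp: kmul_def kstep_def kU_def)
  qed
qed

text \<open>After partial fractions this is q times the entry (p, q) of [T, U] - T S + S T + T T =
  H. Every sum is a difference of harmonic numbers, and all of them cancel except the part between N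
  - p and N, the remnant of the cut at N.\<close>

lemma htail_identity:
  assumes "1 \<le> p" "p \<le> N" "1 \<le> q" "q \<le> N"
  shows "(\<Sum>n | n \<in> {1..N} \<and> n \<le> p \<and> n < q. 1 / (real q - real n))
     - (\<Sum>n | n \<in> {1..N} \<and> p < n \<and> q \<le> n. 1 / (real n - real p) - 1 / real n)
     + (\<Sum>n | n \<in> {1..N} \<and> n \<le> p \<and> q \<le> n. 1 / real n) = htail p"
proof -
  define H where "H = (\<lambda>n. \<Sum>k=1..n. 1 / real k)"
  have iv: "(\<Sum>k\<in>{Suc a..b}. 1 / real k) = H b - H a" if "a \<le> b" for a b
  proof -
    have "{1..b} = {1..a} \<union> {Suc a..b}" using that by auto
    then have "H b = H a + (\<Sum>k\<in>{Suc a..b}. 1 / real k)"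
      unfolding H_def by (simp add: sum.union_disjoint)
    then show ?thesis by simp
  qed
  have ht: "htail p = H N - H (N - p)"
    unfolding htail_def using iv[of "N - p" N] by simp
  \<comment> \<open>Natural subtraction makes one formula serve both cases: for q \<le> p the
    argument \<open>q - 1 - p\<close> is 0 and n runs up to q - 1, otherwise n runs up to p.\<close>
  have refl: "(\<Sum>n | n \<in> {1..N} \<and> n \<le> p \<and> n < q. 1 / (real q - real n)) = H (q - 1) - H (q - 1 - p)"
  proof -
    have "(\<Sum>n | n \<in> {1..N} \<and> n \<le> p \<and> n < q. 1 / (real q - real n))
        = (\<Sum>k\<in>{Suc (q - 1 - p)..q - 1}. 1 / real k)"
      by (rule sum.reindex_bij_witness[of _ "\<lambda>n. q - n" "\<lambda>n. q - n"])
        (use assms in \<open>auto simp: of_nat_diff\<close>)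
    then show ?thesis using iv[of "q - 1 - p" "q - 1"] by simp
  qed
  \<comment> \<open>The second sum starts at \<open>m\<close>, the least n with p < n and q \<le>
    n.\<close>
  define m where "m = max (Suc p) q"
  have S2: "{n. n \<in> {1..N} \<and> p < n \<and> q \<le> n} = {m..N}" using assms by (auto simp: m_def)
  have m: "1 \<le> m" "m \<le> Suc N" "p < m" using assms by (auto simp: m_def)
  have sh: "(\<Sum>n\<in>{m..N}. 1 / (real n - real p)) = H (N - p) - H (m - 1 - p)"
  proof -
    have "(\<Sum>n\<in>{m..N}. 1 / (real n - real p)) = (\<Sum>k\<in>{Suc (m - 1 - p)..N - p}. 1 / real k)"
      by (rule sum.reindex_bij_witness[of _ "\<lambda>n. n + p" "\<lambda>n. n - p"])
        (use m in \<open>auto simp: of_nat_diff\<close>)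
    then show ?thesis using iv[of "m - 1 - p" "N - p"] m by simp
  qed
  have pl: "(\<Sum>n\<in>{m..N}. 1 / real n) = H N - H (m - 1)"
    using iv[of "m - 1" N] m by simp
  have third: "(\<Sum>n | n \<in> {1..N} \<and> n \<le> p \<and> q \<le> n. 1 / real n) = (if q \<le> p then H p - H (q - 1) else 0)"
  proof (cases "q \<le> p")
    case True
    have "{n. n \<in> {1..N} \<and> n \<le> p \<and> q \<le> n} = {Suc (q - 1)..p}" using assms True by auto
    then show ?thesis using iv[of "q - 1" p] True by simp
  next
    case False
    then show ?thesis by (simp add: sum.neutral)
  qed
  have H0: "H 0 = 0" by (simp add: H_def)
  show ?thesis
  proof (cases "q \<le> p")
    case True
    then have "m = Suc p" "q - 1 - p = 0" by (auto simp: m_def)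
    then show ?thesis
      unfolding S2 sum_subtractf sh pl refl third ht using True H0 by simp
  next
    case False
    then have "m = q" by (auto simp: m_def)
    then show ?thesis
      unfolding S2 sum_subtractf sh pl refl third ht using False by simp
  qed
qed

text \<open>Partial fractions as in \<open>comm_step_U\<close>, but the ranges of summation in T U
  and U T are not reflections of each other. Once the factor 1/q is taken out,
  \<open>htail_identity\<close> evaluates the mismatch.\<close>

lemma comm_stepT_U:
  "kstep True \<odot> kU - kU \<odot> kstep True
     = kstep True \<odot> kstep False - kstep False \<odot> kstep True - kstep True \<odot> kstep True + kH"
proof (intro ext)
  fix p q
  show "(kstep True \<odot> kU - kU \<odot> kstep True) p q = (kstep True \<odot> kstep False
      - kstep False \<odot> kstep True - kstep True \<odot> kstep True + kH) p q"
  proof (cases "p \<in> {1..N} \<and> q \<in> {1..N}")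
    case True
    let ?A = "{n. n \<in> {1..N} \<and> n \<le> p \<and> n < q}"
    let ?B = "{n. n \<in> {1..N} \<and> p < n \<and> q \<le> n}"
    let ?C = "{n. n \<in> {1..N} \<and> n \<le> p \<and> q \<le> n}"
    have e: "(kstep True \<odot> kU) p q = (\<Sum>n\<in>?A. 1 / real n * (1 / (real q - real n)))"
      "(kU \<odot> kstep True) p q = (\<Sum>n\<in>?B. 1 / (real n - real p) * (1 / real q))"
      "(kstep True \<odot> kstep False) p q = (\<Sum>n\<in>?A. 1 / real n * (1 / real q))"
      "(kstep False \<odot> kstep True) p q = (\<Sum>n\<in>?B. 1 / real n * (1 / real q))"
      "(kstep True \<odot> kstep True) p q = (\<Sum>n\<in>?C. 1 / real n * (1 / real q))"
      unfolding kmul_def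
      by (rule sum.mono_neutral_cong_right; use True in \<open>auto simp: kstep_def kU_def\<close>)+
    have "(\<Sum>n\<in>?A. 1 / real n * (1 / (real q - real n)))
        = (\<Sum>n\<in>?A. 1 / real n * (1 / real q) + (1 / (real q - real n)) * (1 / real q))"
      using True by (intro sum.cong) (auto simp: field_simps)
    also have "\<dots> = (\<Sum>n\<in>?A. 1 / real n * (1 / real q)) + (\<Sum>n\<in>?A. 1 / (real q - real n)) * (1 / real q)"
      by (simp only: sum.distrib sum_distrib_right[symmetric])
    finally have a: "(kstep True \<odot> kU) p q - (kstep True \<odot> kstep False) p q
        = (\<Sum>n\<in>?A. 1 / (real q - real n)) * (1 / real q)"
      unfolding e by simp
    have b: "(kU \<odot> kstep True) p q - (kstep False \<odot> kstep True) p q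
        = (\<Sum>n\<in>?B. 1 / (real n - real p) - 1 / real n) * (1 / real q)"
      unfolding e sum_subtractf[symmetric] sum_distrib_right by (simp only: left_diff_distrib)
    have c: "(kstep True \<odot> kstep True) p q = (\<Sum>n\<in>?C. 1 / real n) * (1 / real q)"
      unfolding e sum_distrib_right ..
    have h: "kH p q = htail p * (1 / real q)" using True by (simp add: kH_def)
    have "htail p * (1 / real q) = (\<Sum>n\<in>?A. 1 / (real q - real n)) * (1 / real q)
        - (\<Sum>n\<in>?B. 1 / (real n - real p) - 1 / real n) * (1 / real q)
        + (\<Sum>n\<in>?C. 1 / real n) * (1 / real q)"
      using htail_identity[of p q] True
      by (simp only: left_diff_distrib[symmetric] distrib_right[symmetric]) simp
    with a b c h show ?thesis by simp
  next
    case False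
    then show ?thesis by (auto simp: kmul_def kstep_def kU_def kH_def)
  qed
qed


section \<open>Products of kernels and the Leibniz rule\<close>

definition kprod :: "kern list \<Rightarrow> kern" where
  "kprod As = foldr (\<odot>) As kid"

lemma kprod_simps [simp]: "kprod [] = kid" "kprod (A # As) = A \<odot> kprod As"
  by (simp_all add: kprod_def)

lemma ksupp_kprod [simp]: "(\<And>A. A \<in> set As \<Longrightarrow> ksupp A) \<Longrightarrow> ksupp (kprod As)"
  by (induction As) simp_all

lemma kprod_append:
  assumes "\<And>B. B \<in> set Bs \<Longrightarrow> ksupp B"
  shows "kprod (As @ Bs) = kprod As \<odot> kprod Bs"
  by (induction As) (simp_all add: kid_left assms kmul_assoc)

lemma ktrace_kprod_rotate:
  assumes "\<And>B. B \<in> set As \<union> set Bs \<Longrightarrow> ksupp B"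
  shows "ktrace (kprod (As @ Bs)) = ktrace (kprod (Bs @ As))"
  using assms by (simp add: kprod_append ktrace_commute)

text \<open>The Leibniz rule: commutation with \<open>Z\<close> is a derivation, so the commutator
  of a product is a sum over its factors.\<close>

lemma kprod_commutator:
  assumes "\<And>A. A \<in> set As \<Longrightarrow> ksupp A" and "ksupp Z"
  shows "(\<Sum>i<length As. kprod (take i As) \<odot> (As ! i \<odot> Z - Z \<odot> As ! i) \<odot> kprod (drop (Suc i) As))
       = kprod As \<odot> Z - Z \<odot> kprod As"
  using assms
proof (induction As)
  case Nil
  then show ?case by (simp add: kid_left kid_right del: zero_fun_apply)
next
  case (Cons A As)
  let ?t = "\<lambda>i. kprod (take i As) \<odot> (As ! i \<odot> Z - Z \<odot> As ! i) \<odot> kprod (drop (Suc i) As)"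
  have sum_right: "(\<Sum>i\<in>S. A \<odot> f i) = A \<odot> (\<Sum>i\<in>S. f i)" for S :: "nat set" and f
    by (induction S rule: infinite_finite_induct)
      (simp_all add: kmul_add_right del: plus_fun_apply zero_fun_apply)
  have "(\<Sum>i<length (A # As). kprod (take i (A # As)) \<odot> ((A # As) ! i \<odot> Z - Z \<odot> (A # As) ! i)
          \<odot> kprod (drop (Suc i) (A # As)))
      = kid \<odot> (A \<odot> Z - Z \<odot> A) \<odot> kprod As + (\<Sum>i<length As. A \<odot> ?t i)"
    by (simp only: length_Cons sum.lessThan_Suc_shift) (simp add: kmul_assoc del: plus_fun_apply)
  also have "kid \<odot> (A \<odot> Z - Z \<odot> A) \<odot> kprod As = (A \<odot> Z - Z \<odot> A) \<odot> kprod As"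
    using Cons.prems by (simp add: kmul_diff_right kid_left)
  also have "(\<Sum>i<length As. A \<odot> ?t i) = A \<odot> (kprod As \<odot> Z - Z \<odot> kprod As)"
    using Cons.prems by (simp only: sum_right, subst Cons.IH) auto
  also have "(A \<odot> Z - Z \<odot> A) \<odot> kprod As + A \<odot> (kprod As \<odot> Z - Z \<odot> kprod As)
      = kprod (A # As) \<odot> Z - Z \<odot> kprod (A # As)"
    by (simp add: kmul_diff_left kmul_diff_right kmul_assoc)
  finally show ?case .
qed

lemma ktrace_commutator_sum:
  assumes "\<And>A. A \<in> set As \<Longrightarrow> ksupp A" and "ksupp Z"
  shows "(\<Sum>i<length As. ktrace (kprod (take i As) \<odot> (As ! i \<odot> Z - Z \<odot> As ! i)
            \<odot> kprod (drop (Suc i) As))) = 0"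
  using kprod_commutator[OF assms]
  by (simp only: ktrace_sum[symmetric] ktrace_diff) (simp add: ktrace_commute)

section \<open>Kernels of words and of cyclic products\<close>

fun lkern :: "letter \<Rightarrow> kern" where
  "lkern Lx = kX"
| "lkern Ly = kstep False"

definition vkern :: "letter list \<Rightarrow> kern" where
  "vkern w = kprod (map lkern w)"

text \<open>For a block, whose first letter is y: \<open>tl\<close> removes that letter, which acts
  as the weak step T, while any later y is the strict step S of \<open>vkern\<close>.\<close>

definition wkern :: "letter list \<Rightarrow> kern" where
  "wkern w = kstep True \<odot> vkern (tl w)"

lemma ksupp_lkern [simp]: "ksupp (lkern l)"
  by (cases l) simp_all

lemma ksupp_vkern [simp]: "ksupp (vkern w)"
  unfolding vkern_def by (rule ksupp_kprod) auto

lemma ksupp_wkern [simp]: "ksupp (wkern w)"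
  by (simp add: wkern_def)

lemma vkern_Nil [simp]: "vkern [] = kid"
  by (simp add: vkern_def)

lemma vkern_Cons [simp]: "vkern (l # w) = lkern l \<odot> vkern w"
  by (simp add: vkern_def)

lemma vkern_append: "vkern (u @ w) = vkern u \<odot> vkern w"
  unfolding vkern_def map_append by (rule kprod_append) auto

lemma wkern_Ly: "wkern [Ly] = kstep True"
  by (simp add: wkern_def kid_right)

lemma lkern_comm_U: "lkern l \<odot> kU = kU \<odot> lkern l + lkern l \<odot> kstep False"
  using comm_X_U comm_step_U by (cases l) (simp_all add: algebra_simps)

text \<open>Moving U to the left past a letter leaves the letter times S, that is, the letter
  followed by an inserted y; \<open>ins\<close> collects exactly these terms.\<close>

lemma vkern_comm_U: "vkern w \<odot> kU = kU \<odot> vkern w + (\<Sum>v\<leftarrow>ins w. vkern v)"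
proof (induction w)
  case Nil
  show ?case by (simp add: kid_left kid_right del: plus_fun_apply zero_fun_apply)
next
  case (Cons l w)
  have "vkern (l # w) \<odot> kU = lkern l \<odot> (kU \<odot> vkern w + (\<Sum>v\<leftarrow>ins w. vkern v))"
    by (simp only: vkern_Cons kmul_assoc Cons.IH)
  also have "\<dots> = (lkern l \<odot> kU) \<odot> vkern w + (\<Sum>v\<leftarrow>ins w. lkern l \<odot> vkern v)"
    by (simp only: kmul_add_right kmul_assoc kmul_sum_list_right)
  also have "\<dots> = kU \<odot> vkern (l # w) + (vkern (l # Ly # w) + (\<Sum>v\<leftarrow>ins w. lkern l \<odot> vkern v))"
    by (simp only: lkern_comm_U kmul_add_left kmul_assoc vkern_Cons lkern.simps add.assoc)
  also have "vkern (l # Ly # w) + (\<Sum>v\<leftarrow>ins w. lkern l \<odot> vkern v) = (\<Sum>v\<leftarrow>ins (l # w). vkern v)"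
    by (simp add: o_def del: plus_fun_apply)
  finally show ?case .
qed

text \<open>Each term of [T, U] gets a role: T S is the insertion after the head, - S T is half of
  the commutator with S, - T T is a new block y in front, H is the error. The other half of that
  commutator, W S, is the insertion after the last letter; the inner shuffle does not contain it, so
  it is split off here.\<close>

lemma wkern_comm_U:
  assumes "w = Ly # w'" and "w = w0 @ [l]"
  shows "wkern w \<odot> kU - kU \<odot> wkern w
       = (\<Sum>v\<leftarrow>ins w0. wkern (v @ [l])) + (wkern w \<odot> kstep False - kstep False \<odot> wkern w)
         - kstep True \<odot> wkern w + kH \<odot> vkern w'"
proof -
  have wk: "wkern w = kstep True \<odot> vkern w'" by (simp add: assms(1) wkern_def)
  have 1: "wkern w \<odot> kU = (kstep True \<odot> kU) \<odot> vkern w' + kstep True \<odot> (\<Sum>v\<leftarrow>ins w'. vkern v)"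
    by (simp only: wk kmul_assoc vkern_comm_U kmul_add_right)
  have T: "kstep True \<odot> kU = kU \<odot> kstep True + (kstep True \<odot> kstep False - kstep False \<odot> kstep True
      - kstep True \<odot> kstep True + kH)"
    unfolding comm_stepT_U[symmetric] by simp
  \<comment> \<open>T S inserts y after the head; the other insertions take place in the
    tail.\<close>
  have 2: "(\<Sum>v\<leftarrow>ins w. wkern v)
      = kstep True \<odot> kstep False \<odot> vkern w' + kstep True \<odot> (\<Sum>v\<leftarrow>ins w'. vkern v)"
    unfolding assms(1)
    by (simp add: wkern_def o_def kmul_sum_list_right kmul_assoc del: plus_fun_apply)
  have 3: "(\<Sum>v\<leftarrow>ins w. wkern v) = (\<Sum>v\<leftarrow>ins w0. wkern (v @ [l])) + wkern (w @ [Ly])"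
    unfolding assms(2) ins_snoc by (simp add: o_def del: plus_fun_apply)
  have 4: "wkern (w @ [Ly]) = wkern w \<odot> kstep False"
    by (simp add: assms(1) wkern_def vkern_append kmul_assoc kid_right)
  have "wkern w \<odot> kU - kU \<odot> wkern w = (\<Sum>v\<leftarrow>ins w. wkern v)
     - kstep False \<odot> wkern w - kstep True \<odot> wkern w + kH \<odot> vkern w'"
    unfolding 1 T 2 unfolding wk by (simp only: kmul_add_left kmul_diff_left kmul_assoc) (simp add: algebra_simps)
  then show ?thesis unfolding 3 4 by (simp add: algebra_simps)
qed

definition cyc_trace :: "letter list list \<Rightarrow> real" where
  "cyc_trace ws = ktrace (kprod (map wkern ws))"

text \<open>The cyclic product with the T at the head of block i replaced by H, rotated so that this
  block comes first.\<close>

definition cyc_error :: "letter list list \<Rightarrow> nat \<Rightarrow> real" where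
  "cyc_error ws i = ktrace (kH \<odot> (vkern (tl (ws ! i))
     \<odot> kprod (map wkern (drop (Suc i) ws @ take i ws))))"

lemma cyc_trace_rotate: "cyc_trace (us @ vs) = cyc_trace (vs @ us)"
  unfolding cyc_trace_def map_append by (rule ktrace_kprod_rotate) auto

lemma cyc_trace_split:
  "cyc_trace (us @ v # vs) = ktrace (kprod (map wkern us) \<odot> wkern v \<odot> kprod (map wkern vs))"
proof -
  have "kprod (map wkern (us @ v # vs)) = kprod (map wkern us) \<odot> kprod (map wkern (v # vs))"
    unfolding map_append by (rule kprod_append) auto
  then show ?thesis unfolding cyc_trace_def by (simp add: kmul_assoc)
qed

text \<open>Exact for every N. The traces with one factor W replaced by [W, U] add up to zero. In
  their expansion by \<open>wkern_comm_U\<close> the parts [W, S] add up to zero as well, and the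
  rest is the claim.\<close>

lemma cyc_trace_identity:
  assumes "\<And>w. w \<in> set ws \<Longrightarrow> \<exists>w'. w = Ly # w'"
  shows "(\<Sum>i<length ws. \<Sum>v\<leftarrow>ins (butlast (ws ! i)). cyc_trace (ws[i := v @ [last (ws ! i)]]))
       = (\<Sum>i<length ws. cyc_trace (take (Suc i) ws @ [[Ly]] @ drop (Suc i) ws))
         - (\<Sum>i<length ws. cyc_error ws i)"
proof -
  let ?P = "\<lambda>i. kprod (map wkern (take i ws))"
  let ?Q = "\<lambda>i. kprod (map wkern (drop (Suc i) ws))"
  let ?W = "\<lambda>i. wkern (ws ! i)"
  have comm0: "(\<Sum>i<length ws. ktrace (?P i \<odot> (?W i \<odot> Z - Z \<odot> ?W i) \<odot> ?Q i)) = 0" if "ksupp Z" for Z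
  proof -
    have "(\<Sum>i<length ws. ktrace (?P i \<odot> (?W i \<odot> Z - Z \<odot> ?W i) \<odot> ?Q i))
        = (\<Sum>i<length (map wkern ws). ktrace (kprod (take i (map wkern ws))
            \<odot> (map wkern ws ! i \<odot> Z - Z \<odot> map wkern ws ! i) \<odot> kprod (drop (Suc i) (map wkern ws))))"
      by (rule sum.cong) (simp_all add: take_map drop_map del: minus_apply)
    also have "\<dots> = 0" using that by (intro ktrace_commutator_sum) auto
    finally show ?thesis .
  qed
  have each: "ktrace (?P i \<odot> (?W i \<odot> kU - kU \<odot> ?W i) \<odot> ?Q i)
      = (\<Sum>v\<leftarrow>ins (butlast (ws ! i)). cyc_trace (ws[i := v @ [last (ws ! i)]]))
        + ktrace (?P i \<odot> (?W i \<odot> kstep False - kstep False \<odot> ?W i) \<odot> ?Q i)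
        - cyc_trace (take i ws @ [Ly] # drop i ws) + cyc_error ws i"
    if i: "i < length ws" for i
  proof -
    obtain w' where w': "ws ! i = Ly # w'" using assms i nth_mem by blast
    define w0 l where "w0 = butlast (ws ! i)" and "l = last (ws ! i)"
    have wl: "ws ! i = w0 @ [l]" by (simp add: w0_def l_def w')
    have upd: "cyc_trace (ws[i := v @ [l]]) = ktrace (?P i \<odot> wkern (v @ [l]) \<odot> ?Q i)" for v
      using i by (simp add: upd_conv_take_nth_drop cyc_trace_split)
    have insY: "cyc_trace (take i ws @ [Ly] # drop i ws) = ktrace (?P i \<odot> (kstep True \<odot> ?W i) \<odot> ?Q i)"
      using i by (simp add: cyc_trace_split Cons_nth_drop_Suc[symmetric] wkern_Ly kmul_assoc)
    have err: "cyc_error ws i = ktrace (?P i \<odot> (kH \<odot> vkern w') \<odot> ?Q i)"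
    proof -
      have "kprod (map wkern (drop (Suc i) ws @ take i ws)) = ?Q i \<odot> ?P i"
        unfolding map_append by (rule kprod_append) auto
      then have "cyc_error ws i = ktrace ((kH \<odot> vkern w' \<odot> ?Q i) \<odot> ?P i)"
        by (simp add: cyc_error_def w' kmul_assoc)
      also have "\<dots> = ktrace (?P i \<odot> (kH \<odot> vkern w' \<odot> ?Q i))" by (rule ktrace_commute)
      finally show ?thesis by (simp add: kmul_assoc)
    qed
    have s: "?P i \<odot> (\<Sum>v\<leftarrow>ins w0. wkern (v @ [l])) \<odot> ?Q i = (\<Sum>v\<leftarrow>ins w0. ?P i \<odot> wkern (v @ [l]) \<odot> ?Q i)"
      by (simp only: kmul_sum_list_left kmul_sum_list_right)
    show ?thesis
      unfolding wkern_comm_U[OF w' wl] insY err l_def[symmetric] w0_def[symmetric] upd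
        ktrace_sum_list[symmetric] s[symmetric]
      by (simp only: kmul_add_left kmul_add_right kmul_diff_left kmul_diff_right ktrace_add ktrace_diff)
  qed
  \<comment> \<open>\<open>wkern_comm_U\<close> puts the new block y in front of block i, the claim
    puts it behind. The two sums agree because y before the first block and y after the last one
    differ by a rotation.\<close>
  have shift: "(\<Sum>i<length ws. cyc_trace (take i ws @ [Ly] # drop i ws))
      = (\<Sum>i<length ws. cyc_trace (take (Suc i) ws @ [[Ly]] @ drop (Suc i) ws))"
  proof -
    let ?f = "\<lambda>i. cyc_trace (take i ws @ [Ly] # drop i ws)"
    have "?f 0 = ?f (length ws)"
      using cyc_trace_rotate[of "[[Ly]]" ws] by simp
    moreover have "?f 0 + (\<Sum>i<length ws. ?f (Suc i)) = (\<Sum>i<length ws. ?f i) + ?f (length ws)"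
      using sum.lessThan_Suc_shift[of ?f "length ws"] unfolding sum.lessThan_Suc by (rule sym)
    ultimately show ?thesis by simp
  qed
  have "0 = (\<Sum>i<length ws. ktrace (?P i \<odot> (?W i \<odot> kU - kU \<odot> ?W i) \<odot> ?Q i))"
    using comm0[of kU] by simp
  also have "\<dots> = (\<Sum>i<length ws. (\<Sum>v\<leftarrow>ins (butlast (ws ! i)). cyc_trace (ws[i := v @ [last (ws ! i)]]))
        + ktrace (?P i \<odot> (?W i \<odot> kstep False - kstep False \<odot> ?W i) \<odot> ?Q i)
        - cyc_trace (take i ws @ [Ly] # drop i ws) + cyc_error ws i)"
    by (rule sum.cong) (auto simp: each)
  finally show ?thesis
    using comm0[of "kstep False"] by (simp add: sum.distrib sum_subtractf shift)
qed

end

subsection \<open>Truncated cyclic zeta values as traces\<close>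

definition block_weight :: "nat list \<Rightarrow> nat list \<Rightarrow> real" where
  "block_weight ks b = (\<Prod>j<length ks. 1 / real (b ! j) ^ (ks ! j))"

definition cyc_weight :: "nat list list \<Rightarrow> nat list list \<Rightarrow> real" where
  "cyc_weight kk nn = (\<Prod>i<length kk. block_weight (kk ! i) (nn ! i))"

lemma block_weight_simps [simp]:
  "block_weight [] b = 1"
  "block_weight (k # ks) (n # b) = 1 / real n ^ k * block_weight ks b"
  by (simp_all add: block_weight_def prod.lessThan_Suc_shift del: prod.lessThan_Suc)

lemma cyc_weight_simps [simp]:
  "cyc_weight [] nn = 1"
  "cyc_weight (ks # kk) (b # nn) = block_weight ks b * cyc_weight kk nn"
  by (simp_all add: cyc_weight_def prod.lessThan_Suc_shift del: prod.lessThan_Suc)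

definition inc_blocks :: "nat \<Rightarrow> nat \<Rightarrow> nat list set" where
  "inc_blocks N l = {b. length b = l \<and> set b \<subseteq> {1..N} \<and> sorted_wrt (<) b}"

text \<open>The cycle cut open: \<open>(p # map last nn) ! i\<close> is the last entry of the block
  before block i, with p standing in for a block before the first.\<close>

definition block_chains :: "nat \<Rightarrow> nat \<Rightarrow> nat list list \<Rightarrow> nat list list set" where
  "block_chains N p kk = {nn. map length nn = map length kk
     \<and> (\<forall>b\<in>set nn. set b \<subseteq> {1..N} \<and> sorted_wrt (<) b)
     \<and> (\<forall>i<length nn. hd (nn ! i) \<le> (p # map last nn) ! i)}"

lemma finite_inc_blocks [simp]: "finite (inc_blocks N l)"
  by (rule finite_subset[OF _ finite_lists_length_eq[of "{1..N}" l]]) (auto simp: inc_blocks_def)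

lemma sum_Cons:
  assumes "finite A" "\<And>x. x \<in> A \<Longrightarrow> finite (B x)"
  shows "(\<Sum>ys\<in>{x # xs | x xs. x \<in> A \<and> xs \<in> B x}. f ys) = (\<Sum>x\<in>A. \<Sum>xs\<in>B x. f (x # xs))"
proof -
  have eq: "{x # xs | x xs. x \<in> A \<and> xs \<in> B x} = (\<lambda>(x, xs). x # xs) ` Sigma A B" by force
  have "(\<Sum>ys\<in>{x # xs | x xs. x \<in> A \<and> xs \<in> B x}. f ys) = (\<Sum>(x, xs)\<in>Sigma A B. f (x # xs))"
    unfolding eq by (subst sum.reindex) (auto simp: inj_on_def case_prod_beta)
  also have "\<dots> = (\<Sum>x\<in>A. \<Sum>xs\<in>B x. f (x # xs))" using assms by (subst sum.Sigma) auto
  finally show ?thesis .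
qed

lemma block_chains_Nil: "block_chains N p [] = {[]}"
  by (auto simp: block_chains_def)

lemma block_chains_Cons:
  "block_chains N p (ks # kk) = {b # nn | b nn. b \<in> {b \<in> inc_blocks N (length ks). hd b \<le> p} \<and> nn \<in> block_chains N (last b) kk}"
proof -
  have "(\<forall>i<length (b # nn). hd ((b # nn) ! i) \<le> (p # map last (b # nn)) ! i)
      \<longleftrightarrow> hd b \<le> p \<and> (\<forall>i<length nn. hd (nn ! i) \<le> (last b # map last nn) ! i)" for b nn
    by (auto simp: less_Suc_eq_0_disj)
  note * = this[simplified]
  show ?thesis
  proof (rule set_eqI)
    fix nn
    show "nn \<in> block_chains N p (ks # kk) \<longleftrightarrow> nn \<in> {b # nn | b nn.
        b \<in> {b \<in> inc_blocks N (length ks). hd b \<le> p} \<and> nn \<in> block_chains N (last b) kk}"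
      by (cases nn) (simp_all add: block_chains_def inc_blocks_def * conj_ac)
  qed
qed

lemma finite_block_chains [simp]: "finite (block_chains N p kk)"
proof (induction kk arbitrary: p)
  case (Cons ks kk)
  have "block_chains N p (ks # kk) = (\<lambda>(b, nn). b # nn) `
      Sigma {b \<in> inc_blocks N (length ks). hd b \<le> p} (\<lambda>b. block_chains N (last b) kk)"
    unfolding block_chains_Cons by force
  then show ?case using Cons by auto
qed (simp add: block_chains_Nil)

lemma vkern_replicate_Lx:
  assumes "ksupp N A" "n \<in> {1..N}"
  shows "kmul N (vkern N (replicate m Lx)) A n q = A n q / real n ^ m"
proof (induction m)
  case 0
  then show ?case using assms by (simp add: kid_left)
next
  case (Suc m)
  then show ?case
    using assms by (simp only: replicate_Suc vkern_Cons lkern.simps kmul_assoc) (simp add: kX_left)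
qed

text \<open>The letters of one z_k with k = m + 1: y contributes the summation variable n and one
  factor 1/n, each x another factor 1/n.\<close>

lemma kstep_replicate_Lx:
  assumes "ksupp N A" "p \<in> {1..N}"
  shows "kmul N (kstep N f) (kmul N (vkern N (replicate m Lx)) A) p q
    = (\<Sum>n | n \<in> {1..N} \<and> (if f then n \<le> p else p < n). 1 / real n ^ Suc m * A n q)"
proof -
  have "(\<Sum>n=1..N. kstep N f p n * kmul N (vkern N (replicate m Lx)) A n q)
      = (\<Sum>n=1..N. if (if f then n \<le> p else p < n) then 1 / real n ^ Suc m * A n q else 0)"
    by (rule sum.cong) (use assms in \<open>auto simp: vkern_replicate_Lx kstep_def\<close>)
  also have "\<dots> = (\<Sum>n | n \<in> {1..N} \<and> (if f then n \<le> p else p < n). 1 / real n ^ Suc m * A n q)"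
    by (subst sum.inter_filter) auto
  finally show ?thesis by (simp add: kmul_def)
qed

lemma zword_Cons: "zword (k # ks) = Ly # replicate (k - 1) Lx @ zword ks"
  by (simp add: zword_def)

text \<open>An entry of a matrix product is a sum over paths, here the strictly increasing
  continuations of p that end in q. Writing \<open>last (p # b)\<close> covers the empty block,
  where p = q.\<close>

lemma vkern_zword:
  assumes "p \<in> {1..N}" "\<forall>k\<in>set ks. 1 \<le> k"
  shows "vkern N (zword ks) p q
    = (\<Sum>b | b \<in> inc_blocks N (length ks) \<and> sorted_wrt (<) (p # b) \<and> last (p # b) = q. block_weight ks b)"
  using assms
proof (induction ks arbitrary: p)
  case Nil
  have "{b. b \<in> inc_blocks N (length []) \<and> sorted_wrt (<) (p # b) \<and> last (p # b) = q} = (if p = q then {[]} else {})"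
    by (auto simp: inc_blocks_def)
  then show ?case using Nil by (simp add: zword_def kid_def)
next
  case (Cons k ks)
  have k: "Suc (k - 1) = k" using Cons.prems by simp
  have set: "{b. b \<in> inc_blocks N (length (k # ks)) \<and> sorted_wrt (<) (p # b) \<and> last (p # b) = q}
     = {n # b | n b. n \<in> {n. n \<in> {1..N} \<and> p < n}
          \<and> b \<in> {b. b \<in> inc_blocks N (length ks) \<and> sorted_wrt (<) (n # b) \<and> last (n # b) = q}}"
  proof (rule set_eqI)
    fix b
    show "b \<in> {b. b \<in> inc_blocks N (length (k # ks)) \<and> sorted_wrt (<) (p # b) \<and> last (p # b) = q}
        \<longleftrightarrow> b \<in> {n # b | n b. n \<in> {n. n \<in> {1..N} \<and> p < n}
          \<and> b \<in> {b. b \<in> inc_blocks N (length ks) \<and> sorted_wrt (<) (n # b) \<and> last (n # b) = q}}"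
    proof (cases b)
      case (Cons n b')
      have "p < y" if "p < n" "\<forall>y\<in>set b'. n < y" "y \<in> set b'" for y
        using that by (meson less_trans)
      then show ?thesis unfolding Cons by (simp add: inc_blocks_def) blast
    qed (simp add: inc_blocks_def)
  qed
  have "vkern N (zword (k # ks)) p q
      = kmul N (kstep N False) (kmul N (vkern N (replicate (k - 1) Lx)) (vkern N (zword ks))) p q"
    by (simp add: zword_Cons vkern_append)
  also have "\<dots> = (\<Sum>n | n \<in> {1..N} \<and> p < n. 1 / real n ^ k * vkern N (zword ks) n q)"
    using Cons.prems by (subst kstep_replicate_Lx) (simp_all only: ksupp_vkern k if_False)
  also have "\<dots> = (\<Sum>n | n \<in> {1..N} \<and> p < n.
      \<Sum>b | b \<in> inc_blocks N (length ks) \<and> sorted_wrt (<) (n # b) \<and> last (n # b) = q. block_weight (k # ks) (n # b))"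
    using Cons.prems by (intro sum.cong[OF refl]) (simp add: Cons.IH sum_distrib_left)
  also have "\<dots> = (\<Sum>b | b \<in> inc_blocks N (length (k # ks)) \<and> sorted_wrt (<) (p # b) \<and> last (p # b) = q.
      block_weight (k # ks) b)"
    unfolding set by (rule sum_Cons[symmetric]) auto
  finally show ?case .
qed

lemma wkern_zword:
  assumes "p \<in> {1..N}" "\<forall>k\<in>set ks. 1 \<le> k" "ks \<noteq> []"
  shows "wkern N (zword ks) p q
    = (\<Sum>b | b \<in> inc_blocks N (length ks) \<and> hd b \<le> p \<and> last b = q. block_weight ks b)"
proof -
  obtain k ks' where ks: "ks = k # ks'" using assms by (cases ks) auto
  have k: "Suc (k - 1) = k" using assms ks by simp
  have set: "{b. b \<in> inc_blocks N (length (k # ks')) \<and> hd b \<le> p \<and> last b = q}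
     = {n # b | n b. n \<in> {n. n \<in> {1..N} \<and> n \<le> p}
          \<and> b \<in> {b. b \<in> inc_blocks N (length ks') \<and> sorted_wrt (<) (n # b) \<and> last (n # b) = q}}"
  proof (rule set_eqI)
    fix b
    show "b \<in> {b. b \<in> inc_blocks N (length (k # ks')) \<and> hd b \<le> p \<and> last b = q}
        \<longleftrightarrow> b \<in> {n # b | n b. n \<in> {n. n \<in> {1..N} \<and> n \<le> p}
          \<and> b \<in> {b. b \<in> inc_blocks N (length ks') \<and> sorted_wrt (<) (n # b) \<and> last (n # b) = q}}"
      by (cases b) (simp_all add: inc_blocks_def conj_ac)
  qed
  have "wkern N (zword ks) p q
      = kmul N (kstep N True) (kmul N (vkern N (replicate (k - 1) Lx)) (vkern N (zword ks'))) p q"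
    by (simp add: ks zword_Cons vkern_append wkern_def)
  also have "\<dots> = (\<Sum>n | n \<in> {1..N} \<and> n \<le> p. 1 / real n ^ k * vkern N (zword ks') n q)"
    using assms by (subst kstep_replicate_Lx) (simp_all only: ksupp_vkern k if_True)
  also have "\<dots> = (\<Sum>n | n \<in> {1..N} \<and> n \<le> p.
      \<Sum>b | b \<in> inc_blocks N (length ks') \<and> sorted_wrt (<) (n # b) \<and> last (n # b) = q. block_weight (k # ks') (n # b))"
    using assms ks by (intro sum.cong[OF refl]) (simp add: vkern_zword sum_distrib_left)
  also have "\<dots> = (\<Sum>b | b \<in> inc_blocks N (length ks) \<and> hd b \<le> p \<and> last b = q. block_weight ks b)"
    unfolding ks set by (rule sum_Cons[symmetric]) auto
  finally show ?thesis .
qed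

definition pos_indices :: "nat list list \<Rightarrow> bool" where
  "pos_indices kk \<longleftrightarrow> (\<forall>ks\<in>set kk. ks \<noteq> [] \<and> (\<forall>k\<in>set ks. 1 \<le> k))"

lemma kprod_zword:
  assumes "p \<in> {1..N}" "pos_indices kk"
  shows "kprod N (map (\<lambda>ks. wkern N (zword ks)) kk) p q
    = (\<Sum>nn | nn \<in> block_chains N p kk \<and> last (p # map last nn) = q. cyc_weight kk nn)"
  using assms
proof (induction kk arbitrary: p)
  case Nil
  have "{nn. nn \<in> block_chains N p [] \<and> last (p # map last nn) = q} = (if p = q then {[]} else {})"
    by (auto simp: block_chains_Nil)
  then show ?case using Nil by (simp add: kid_def)
next
  case (Cons ks kk)
  let ?B = "{b \<in> inc_blocks N (length ks). hd b \<le> p}"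
  let ?C = "\<lambda>b. {nn. nn \<in> block_chains N (last b) kk \<and> last (last b # map last nn) = q}"
  let ?f = "\<lambda>n. kprod N (map (\<lambda>ks. wkern N (zword ks)) kk) n q"
  have ks: "ks \<noteq> []" "\<forall>k\<in>set ks. 1 \<le> k" "pos_indices kk" using Cons.prems by (auto simp: pos_indices_def)
  have last: "last b \<in> {1..N}" if "b \<in> ?B" for b
  proof -
    have "b \<noteq> []" "set b \<subseteq> {1..N}" using that ks by (auto simp: inc_blocks_def)
    then show ?thesis using last_in_set by blast
  qed
  have set: "{nn. nn \<in> block_chains N p (ks # kk) \<and> last (p # map last nn) = q}
      = {b # nn | b nn. b \<in> ?B \<and> nn \<in> ?C b}"
    unfolding block_chains_Cons by force
  have "kprod N (map (\<lambda>ks. wkern N (zword ks)) (ks # kk)) p q = (\<Sum>n=1..N. wkern N (zword ks) p n * ?f n)"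
    by (simp add: kmul_def)
  \<comment> \<open>The matrix index n between the first block and the rest is the last entry of
    that block, so the blocks come grouped by it; the next step removes the grouping.\<close>
  also have "\<dots> = (\<Sum>n=1..N. \<Sum>b | b \<in> ?B \<and> last b = n. block_weight ks b * ?f (last b))"
  proof (rule sum.cong[OF refl])
    fix n
    show "wkern N (zword ks) p n * ?f n = (\<Sum>b | b \<in> ?B \<and> last b = n. block_weight ks b * ?f (last b))"
      unfolding wkern_zword[OF Cons.prems(1) ks(2,1)] sum_distrib_right
      by (rule sum.cong) (simp_all add: conj_assoc)
  qed
  also have "\<dots> = (\<Sum>b\<in>?B. block_weight ks b * ?f (last b))"
    by (rule sum.group) (use last in auto)
  also have "\<dots> = (\<Sum>b\<in>?B. \<Sum>nn\<in>?C b. cyc_weight (ks # kk) (b # nn))"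
    by (rule sum.cong[OF refl]) (simp only: Cons.IH[OF last ks(3)] cyc_weight_simps sum_distrib_left)
  also have "\<dots> = (\<Sum>nn | nn \<in> block_chains N p (ks # kk) \<and> last (p # map last nn) = q. cyc_weight (ks # kk) nn)"
    unfolding set by (rule sum_Cons[symmetric]) auto
  finally show ?case .
qed

definition cyc_domain_le :: "nat \<Rightarrow> nat list list \<Rightarrow> nat list list set" where
  "cyc_domain_le N kk = {nn \<in> cyc_domain kk. \<forall>b\<in>set nn. \<forall>n\<in>set b. n \<le> N}"

text \<open>Passes from successors modulo the length, as in \<open>cyc_domain\<close>, to
  predecessors, as in \<open>block_chains\<close>; the cycle is cut after its last block.\<close>

lemma cyclic_shift_iff:
  assumes "nn \<noteq> []"
  shows "(\<forall>i<length nn. hd (nn ! i) \<le> (last (last nn) # map last nn) ! i)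
    \<longleftrightarrow> (\<forall>i<length nn. last (nn ! i) \<ge> hd (nn ! (Suc i mod length nn)))" (is "?L \<longleftrightarrow> ?R")
proof
  assume L: ?L
  show ?R
  proof (intro allI impI)
    fix i assume i: "i < length nn"
    show "last (nn ! i) \<ge> hd (nn ! (Suc i mod length nn))"
    proof (cases "Suc i = length nn")
      case True
      then have "nn ! i = last nn" by (metis assms diff_Suc_1 last_conv_nth)
      then show ?thesis using L[rule_format, of 0] True assms by simp
    next
      case False
      then show ?thesis using L[rule_format, of "Suc i"] i by simp
    qed
  qed
next
  assume R: ?R
  show ?L
  proof (intro allI impI)
    fix i assume i: "i < length nn"
    show "hd (nn ! i) \<le> (last (last nn) # map last nn) ! i"
    proof (cases i)
      case 0
      then show ?thesis using R[rule_format, of "length nn - 1"] assms by (simp add: last_conv_nth)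
    next
      case (Suc j)
      then show ?thesis using R[rule_format, of j] i by simp
    qed
  qed
qed

text \<open>Diagonal entries close the chain: the starting value p is then the last entry of the
  last block.\<close>

lemma cyc_domain_le_eq_chains:
  assumes "kk \<noteq> []"
  shows "{nn \<in> cyc_domain_le N kk. last (last nn) = p} = {nn. nn \<in> block_chains N p kk \<and> last (p # map last nn) = p}"
proof (rule set_eqI)
  fix nn
  show "nn \<in> {nn \<in> cyc_domain_le N kk. last (last nn) = p}
     \<longleftrightarrow> nn \<in> {nn. nn \<in> block_chains N p kk \<and> last (p # map last nn) = p}"
  proof (cases "nn = []")
    case True
    then show ?thesis using assms by (auto simp: cyc_domain_le_def cyc_domain_def block_chains_def)
  next
    case False
    have sub: "(\<forall>b\<in>set nn. set b \<subseteq> {1..N} \<and> sorted_wrt (<) b) \<longleftrightarrow>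
       (\<forall>b\<in>set nn. (\<forall>n\<in>set b. n \<ge> 1) \<and> sorted_wrt (<) b) \<and> (\<forall>b\<in>set nn. \<forall>n\<in>set b. n \<le> N)"
      by fastforce
    have last: "last (p # map last nn) = last (last nn)" using False by (simp add: last_map)
    show ?thesis
      unfolding cyc_domain_le_def cyc_domain_def block_chains_def last mem_Collect_eq sub
        cyclic_shift_iff[OF False, symmetric]
      by blast
  qed
qed

lemma finite_cyc_domain_le [simp]: "finite (cyc_domain_le N kk)"
proof -
  have "cyc_domain_le N kk \<subseteq> {nn. set nn \<subseteq> {b. set b \<subseteq> {..N} \<and> length b \<le> sum_list (map length kk)}
      \<and> length nn = length kk}"
  proof (safe)
    fix nn b n assume nn: "nn \<in> cyc_domain_le N kk" and b: "b \<in> set nn"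
    then have len: "map length nn = map length kk" by (simp add: cyc_domain_le_def cyc_domain_def)
    have "length b \<in> set (map length kk)" using b unfolding len[symmetric] by simp
    then show "length b \<le> sum_list (map length kk)" by (rule member_le_sum_list) simp
    assume "n \<in> set b"
    with nn b show "n \<le> N" by (auto simp: cyc_domain_le_def)
  next
    fix nn assume "nn \<in> cyc_domain_le N kk"
    then show "length nn = length kk"
      by (auto simp: cyc_domain_le_def cyc_domain_def dest: map_eq_imp_length_eq)
  qed
  moreover have "finite {nn. set nn \<subseteq> {b. set b \<subseteq> {..N} \<and> length b \<le> sum_list (map length kk)}
      \<and> length nn = length kk}"
    by (intro finite_lists_length_eq finite_lists_length_le) simp
  ultimately show ?thesis by (rule finite_subset)
qed

lemma cyc_trace_zword:
  assumes "kk \<noteq> []" "pos_indices kk"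
  shows "cyc_trace N (map zword kk) = (\<Sum>nn\<in>cyc_domain_le N kk. cyc_weight kk nn)"
proof -
  have "cyc_trace N (map zword kk) = (\<Sum>p=1..N. kprod N (map (\<lambda>ks. wkern N (zword ks)) kk) p p)"
    by (simp only: cyc_trace_def ktrace_def map_map o_def)
  also have "\<dots> = (\<Sum>p=1..N. \<Sum>nn | nn \<in> cyc_domain_le N kk \<and> last (last nn) = p. cyc_weight kk nn)"
    by (rule sum.cong[OF refl]) (simp only: kprod_zword[OF _ assms(2)] cyc_domain_le_eq_chains[OF assms(1)])
  also have "\<dots> = (\<Sum>nn\<in>cyc_domain_le N kk. cyc_weight kk nn)"
  proof (rule sum.group)
    show "(\<lambda>nn. last (last nn)) ` cyc_domain_le N kk \<subseteq> {1..N}"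
    proof safe
      fix nn assume nn: "nn \<in> cyc_domain_le N kk"
      then have len: "map length nn = map length kk"
        and le: "\<And>b n. b \<in> set nn \<Longrightarrow> n \<in> set b \<Longrightarrow> 1 \<le> n \<and> n \<le> N"
        by (auto simp: cyc_domain_le_def cyc_domain_def)
      have ne: "nn \<noteq> []" using len assms by auto
      then have "length (last nn) \<in> set (map length kk)" unfolding len[symmetric] by auto
      then have "last nn \<noteq> []" using assms(2) by (auto simp: pos_indices_def)
      with le[of "last nn" "last (last nn)"] ne show "last (last nn) \<in> {1..N}" by simp
    qed
  qed auto
  finally show ?thesis .
qed

lemma cyc_weight_nonneg: "0 \<le> cyc_weight kk nn"
  unfolding cyc_weight_def block_weight_def by (intro prod_nonneg) auto

text \<open>\<open>infsum\<close> is 0 by convention for families that are not summable, so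
  convergence has to be shown first: the weights are nonnegative, hence the bound on the traces
  makes them summable. The truncated domains then exhaust \<open>cyc_domain\<close>.\<close>

lemma cyc_trace_tendsto_zeta_cyc:
  assumes kk: "kk \<noteq> []" "pos_indices kk" and B: "\<And>N. cyc_trace N (map zword kk) \<le> B"
  shows "(\<lambda>N. cyc_trace N (map zword kk)) \<longlonglongrightarrow> zeta_cyc kk"
proof -
  let ?D = "cyc_domain kk"
  have zeta: "zeta_cyc kk = infsum (cyc_weight kk) ?D"
    unfolding zeta_cyc_def cyc_weight_def block_weight_def ..
  have sub: "cyc_domain_le N kk \<subseteq> ?D" for N by (auto simp: cyc_domain_le_def)
  have ex: "\<forall>\<^sub>F N in sequentially. F \<subseteq> cyc_domain_le N kk" if F: "finite F" "F \<subseteq> ?D" for F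
  proof -
    \<comment> \<open>Every entry of every tuple in \<open>F\<close>; a cut at or above the maximum
      keeps all of \<open>F\<close>. The 0 inserted below keeps \<open>Max\<close> meaningful for
      empty \<open>S\<close>.\<close>
    define S where "S = (\<Union>nn\<in>F. \<Union>b\<in>set nn. set b)"
    have S: "finite S" using F by (auto simp: S_def)
    have "F \<subseteq> cyc_domain_le N kk" if "Max (insert 0 S) \<le> N" for N
    proof
      fix nn assume "nn \<in> F"
      have "n \<le> N" if "b \<in> set nn" "n \<in> set b" for b n
      proof -
        have "n \<in> S" using that \<open>nn \<in> F\<close> unfolding S_def by blast
        then have "n \<le> Max (insert 0 S)" using S by simp
        with \<open>Max (insert 0 S) \<le> N\<close> show ?thesis by linarith
      qed
      then show "nn \<in> cyc_domain_le N kk" using F \<open>nn \<in> F\<close> unfolding cyc_domain_le_def by blast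
    qed
    then show ?thesis by (rule eventually_sequentiallyI)
  qed
  have "cyc_weight kk summable_on ?D"
  proof (rule nonneg_bdd_above_summable_on)
    show "bdd_above (sum (cyc_weight kk) ` {F. F \<subseteq> ?D \<and> finite F})"
    proof (rule bdd_aboveI)
      fix x assume "x \<in> sum (cyc_weight kk) ` {F. F \<subseteq> ?D \<and> finite F}"
      then obtain F where F: "F \<subseteq> ?D" "finite F" "x = sum (cyc_weight kk) F" by auto
      obtain N where "F \<subseteq> cyc_domain_le N kk" using eventually_happens'[OF sequentially_bot ex[OF F(2,1)]] by blast
      then have "x \<le> sum (cyc_weight kk) (cyc_domain_le N kk)"
        unfolding F(3) by (intro sum_mono2) (auto simp: cyc_weight_nonneg)
      also have "\<dots> \<le> B" using B[of N] kk by (simp add: cyc_trace_zword)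
      finally show "x \<le> B" .
    qed
  qed (simp add: cyc_weight_nonneg)
  then have "(cyc_weight kk has_sum zeta_cyc kk) ?D" unfolding zeta by (rule has_sum_infsum)
  then have "(sum (cyc_weight kk) \<longlongrightarrow> zeta_cyc kk) (finite_subsets_at_top ?D)"
    by (simp add: has_sum_def)
  moreover have "filterlim (\<lambda>N. cyc_domain_le N kk) (finite_subsets_at_top ?D) sequentially"
    unfolding filterlim_finite_subsets_at_top
  proof (intro allI impI)
    fix F assume "finite F \<and> F \<subseteq> ?D"
    then show "\<forall>\<^sub>F N in sequentially. finite (cyc_domain_le N kk) \<and> F \<subseteq> cyc_domain_le N kk \<and> cyc_domain_le N kk \<subseteq> ?D"
      using ex[of F] sub by (auto elim!: eventually_mono)
  qed
  ultimately have "(\<lambda>N. sum (cyc_weight kk) (cyc_domain_le N kk)) \<longlonglongrightarrow> zeta_cyc kk"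
    by (rule filterlim_compose)
  then show ?thesis using kk by (simp add: cyc_trace_zword)
qed

subsection \<open>Growth estimates\<close>

text \<open>The words of (1) and of the admissible indices: a final x means that the last entry of
  the index is at least 2.\<close>

definition adm_word :: "letter list \<Rightarrow> bool" where
  "adm_word w \<longleftrightarrow> w = [Ly] \<or> (\<exists>u. w = Ly # u @ [Lx])"

text \<open>Row vector times kernel, so that one row of a long product can be estimated factor by
  factor.\<close>

definition kact :: "nat \<Rightarrow> (nat \<Rightarrow> real) \<Rightarrow> kern \<Rightarrow> nat \<Rightarrow> real" where
  "kact N r A q = (\<Sum>n=1..N. r n * A n q)"

lemma kact_kmul: "kact N r (kmul N A B) = kact N (kact N r A) B"
  unfolding kact_def kmul_def sum_distrib_left sum_distrib_right
  by (intro ext, subst sum.swap) (simp add: mult.assoc)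

lemma kmul_row: "kmul N A B p = kact N (A p) B"
  by (simp add: kact_def kmul_def fun_eq_iff)

lemma kact_kid: "q \<in> {1..N} \<Longrightarrow> kact N r (kid N) q = r q"
proof -
  assume q: "q \<in> {1..N}"
  have "kact N r (kid N) q = (\<Sum>n=1..N. if n = q then r q else 0)"
    unfolding kact_def by (rule sum.cong) (auto simp: kid_def)
  with q show ?thesis by simp
qed

lemma kact_kX: "q \<in> {1..N} \<Longrightarrow> kact N r (kX N) q = r q / real q"
proof -
  assume q: "q \<in> {1..N}"
  have "kact N r (kX N) q = (\<Sum>n=1..N. if n = q then r q / real q else 0)"
    unfolding kact_def by (rule sum.cong) (auto simp: kX_def)
  with q show ?thesis by simp
qed

text \<open>
  Follow a row vector that starts as \<open>[q \<le> p] / q\<close> through the product. Blocks \<open>y\<close> alone keep it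
  supported on \<open>q \<le> p\<close> (\<open>row_harm\<close>), at the cost of logarithms of \<open>p\<close>; the final \<open>x\<close> of the first
  other block gains a factor \<open>1 / q\<close>, which later blocks preserve (\<open>row_le\<close> with exponent near \<open>-2\<close>).
  All logarithms are absorbed into small powers \<open>d\<close>, one for each letter \<open>y\<close>.
\<close>

definition row_le :: "nat \<Rightarrow> real \<Rightarrow> real \<Rightarrow> (nat \<Rightarrow> real) \<Rightarrow> bool" where
  "row_le N K e r \<longleftrightarrow> (\<forall>q\<in>{1..N}. 0 \<le> r q \<and> r q \<le> K * real q powr e)"

definition row_harm :: "nat \<Rightarrow> nat \<Rightarrow> real \<Rightarrow> (nat \<Rightarrow> real) \<Rightarrow> bool" where
  "row_harm N p K r \<longleftrightarrow> (\<forall>q\<in>{1..N}. 0 \<le> r q \<and> r q \<le> of_bool (q \<le> p) * K / real q)"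

lemma row_le_kid: "row_le N K e (kact N r (kid N)) \<longleftrightarrow> row_le N K e r"
  by (simp add: row_le_def kact_kid)

lemma row_le_mono:
  assumes "row_le N K e r" "0 \<le> K" "K \<le> K'" "e \<le> e'"
  shows "row_le N K' e' r"
  unfolding row_le_def
proof (intro ballI conjI)
  fix q assume q: "q \<in> {1..N}"
  with assms(1) show "0 \<le> r q" by (auto simp: row_le_def)
  have "r q \<le> K * real q powr e" using assms(1) q by (auto simp: row_le_def)
  also have "\<dots> \<le> K' * real q powr e'"
    using q assms by (intro mult_mono powr_mono) auto
  finally show "r q \<le> K' * real q powr e'" .
qed

lemma row_harm_imp_row_le: "row_harm N p K r \<Longrightarrow> 0 \<le> K \<Longrightarrow> row_le N K (- 1) r"
  unfolding row_harm_def row_le_def by (fastforce simp: powr_minus_divide of_bool_def split: if_splits)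

lemma row_le_kX: "row_le N K (e + 1) r \<Longrightarrow> row_le N K e (kact N r (kX N))"
  unfolding row_le_def
proof (intro ballI conjI)
  fix q assume r: "\<forall>q\<in>{1..N}. 0 \<le> r q \<and> r q \<le> K * real q powr (e + 1)" and q: "q \<in> {1..N}"
  from r q show "0 \<le> kact N r (kX N) q" by (simp add: kact_kX)
  have "r q \<le> K * (real q powr e * real q)" using r q by (auto simp: powr_add)
  then show "kact N r (kX N) q \<le> K * real q powr e"
    using q by (simp add: kact_kX divide_le_eq mult.assoc)
qed

text \<open>\<open>C\<close> bounds the partial sums of zeta(1 + d), and \<open>D\<close> is the
  price of one letter y: a power n^d is traded for convergence, at the cost of p^d when only n \<le>
  p is known. Below, j counts the letters y read so far; the constant is then D^j and the exponent
  is shifted by j d.\<close>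

context
  fixes N p :: nat and d C D :: real
  assumes p: "1 \<le> p" "p \<le> N" and d: "0 < d"
    and C: "\<And>M. (\<Sum>n=1..M. real n powr (-1 - d)) \<le> C"
  defines "D \<equiv> C * real p powr d"
begin

lemma C_ge_1: "1 \<le> C"
  using C[of 1] by simp

lemma C_le_D: "C \<le> D"
  using C_ge_1 p d ge_one_powr_ge_zero[of "real p" d] unfolding D_def
  by (simp add: mult_le_cancel_left1)

lemma D_ge_1: "1 \<le> D"
  using C_ge_1 C_le_D by linarith

text \<open>Domination by the convergent series of n^(-1-d), the common last step of the three
  estimates for \<open>kstep\<close>.\<close>

lemma kact_le:
  assumes "\<And>n. n \<in> {1..N} \<Longrightarrow> 0 \<le> r n * A n q" "0 \<le> G"
    and "\<And>n. n \<in> {1..N} \<Longrightarrow> r n * A n q \<le> G * real n powr (-1 - d)"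
  shows "0 \<le> kact N r A q" "kact N r A q \<le> G * C"
proof -
  show "0 \<le> kact N r A q" unfolding kact_def by (rule sum_nonneg) (use assms in auto)
  have "kact N r A q \<le> G * (\<Sum>n=1..N. real n powr (-1 - d))"
    unfolding kact_def sum_distrib_left by (rule sum_mono) (use assms in auto)
  also have "\<dots> \<le> G * C" using C assms by (intro mult_left_mono) auto
  finally show "kact N r A q \<le> G * C" .
qed

text \<open>The new entry at q is at most 1/q times the sum of K/n over n \<le> p, where 1/n \<le>
  p^d n^(-1-d). For q > p there is no n with q \<le> n \<le> p, so the support is kept.\<close>

lemma row_harm_kstep_True:
  assumes r: "row_harm N p K r" and K: "0 \<le> K"
  shows "row_harm N p (K * D) (kact N r (kstep N True))"
  unfolding row_harm_def
proof (intro ballI)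
  fix q assume q: "q \<in> {1..N}"
  have r0: "0 \<le> r n" "r n \<le> of_bool (n \<le> p) * K / real n" if "n \<in> {1..N}" for n
    using r that by (auto simp: row_harm_def)
  show "0 \<le> kact N r (kstep N True) q \<and> kact N r (kstep N True) q \<le> of_bool (q \<le> p) * (K * D) / real q"
  proof (cases "q \<le> p")
    case True
    have *: "r n * kstep N True n q \<le> K * real p powr d / real q * real n powr (-1 - d)" if n: "n \<in> {1..N}" for n
    proof (cases "n \<le> p")
      case True
      have "r n \<le> K / real n" using r0[OF n] True by simp
      also have "K / real n = K * (real n powr d * real n powr (-1 - d))"
        using n by (simp add: powr_add[symmetric] powr_minus_divide)
      also have "\<dots> \<le> K * (real p powr d * real n powr (-1 - d))"
        using True K d n by (intro mult_left_mono mult_right_mono powr_mono2) auto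
      finally have "r n \<le> K * real p powr d * real n powr (-1 - d)" by (simp add: mult.assoc)
      moreover have "0 \<le> kstep N True n q" "kstep N True n q \<le> 1 / real q" by (auto simp: kstep_def)
      ultimately have "r n * kstep N True n q \<le> K * real p powr d * real n powr (-1 - d) * (1 / real q)"
        using r0[OF n] K by (intro mult_mono) auto
      then show ?thesis by simp
    next
      case False
      then have "r n = 0" using r0[OF n] by simp
      then show ?thesis using K by simp
    qed
    have nonneg: "0 \<le> r n * kstep N True n q" if "n \<in> {1..N}" for n
      using r0(1)[OF that] by (simp add: kstep_def)
    have "0 \<le> K * real p powr d / real q" using K by simp
    note kact_le[of r "kstep N True" q, OF nonneg this *]
    then show ?thesis using True by (simp add: D_def mult_ac)
  next
    case False
    have "r n * kstep N True n q = 0" if n: "n \<in> {1..N}" for n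
      using r0[OF n] False by (auto simp: kstep_def)
    then have "kact N r (kstep N True) q = 0" unfolding kact_def by (intro sum.neutral) blast
    then show ?thesis using False by simp
  qed
qed

text \<open>Split n^(b-2) = n^(b+d-1) n^(-1-d). Since b + d \<le> 1 and n \<ge> q, the first factor
  is at most q^(b+d-1), and the 1/q of the step brings the exponent to b + d - 2.\<close>

lemma row_le_kstep_True:
  assumes r: "row_le N K (b - 2) r" and K: "0 \<le> K" and b: "b + d \<le> 1"
  shows "row_le N (K * D) (b + d - 2) (kact N r (kstep N True))"
proof -
  have "row_le N (K * C) (b + d - 2) (kact N r (kstep N True))"
    unfolding row_le_def
  proof (intro ballI)
    fix q assume q: "q \<in> {1..N}"
    have r0: "0 \<le> r n" "r n \<le> K * real n powr (b - 2)" if "n \<in> {1..N}" for n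
      using r that by (auto simp: row_le_def)
    have le: "r n * kstep N True n q \<le> K * real q powr (b + d - 2) * real n powr (-1 - d)"
      if n: "n \<in> {1..N}" for n
    proof (cases "q \<le> n")
      case True
      have "r n \<le> K * (real n powr (b + d - 1) * real n powr (-1 - d))"
        using r0[OF n] n by (simp add: powr_add[symmetric])
      also have "\<dots> \<le> K * (real q powr (b + d - 1) * real n powr (-1 - d))"
        using True K b q by (intro mult_left_mono mult_right_mono powr_mono2') auto
      also have "real q powr (b + d - 1) = real q powr (b + d - 2) * real q"
        using q powr_add[of "real q" "b + d - 2" 1] by simp
      finally show ?thesis using q n True by (simp add: kstep_def divide_le_eq mult_ac)
    next
      case False
      then show ?thesis using K by (simp add: kstep_def)
    qed
    have nonneg: "0 \<le> r n * kstep N True n q" if "n \<in> {1..N}" for n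
      using r0(1)[OF that] by (simp add: kstep_def)
    have "0 \<le> K * real q powr (b + d - 2)" using K by simp
    from kact_le[of r "kstep N True" q, OF nonneg this le]
    show "0 \<le> kact N r (kstep N True) q
        \<and> kact N r (kstep N True) q \<le> K * C * real q powr (b + d - 2)"
      by (simp only: mult_ac simp_thms)
  qed
  then show ?thesis
    by (rule row_le_mono) (use K C_ge_1 C_le_D in \<open>auto intro: mult_left_mono\<close>)
qed

text \<open>The analogous split n^(b-1) = n^(b+d) n^(-1-d), now with a nonnegative exponent b + d
  and n < q.\<close>

lemma row_le_kstep_False:
  assumes r: "row_le N K (b - 1) r" and K: "0 \<le> K" and b: "0 \<le> b"
  shows "row_le N (K * D) (b + d - 1) (kact N r (kstep N False))"
proof -
  have "row_le N (K * C) (b + d - 1) (kact N r (kstep N False))"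
    unfolding row_le_def
  proof (intro ballI)
    fix q assume q: "q \<in> {1..N}"
    have r0: "0 \<le> r n" "r n \<le> K * real n powr (b - 1)" if "n \<in> {1..N}" for n
      using r that by (auto simp: row_le_def)
    have le: "r n * kstep N False n q \<le> K * real q powr (b + d - 1) * real n powr (-1 - d)"
      if n: "n \<in> {1..N}" for n
    proof (cases "n < q")
      case True
      have "r n \<le> K * (real n powr (b + d) * real n powr (-1 - d))"
        using r0[OF n] n by (simp add: powr_add[symmetric])
      also have "\<dots> \<le> K * (real q powr (b + d) * real n powr (-1 - d))"
        using True K b d q by (intro mult_left_mono mult_right_mono powr_mono2) auto
      also have "real q powr (b + d) = real q powr (b + d - 1) * real q"
        using q powr_add[of "real q" "b + d - 1" 1] by simp
      finally show ?thesis using q n True by (simp add: kstep_def divide_le_eq mult_ac)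
    next
      case False
      then show ?thesis using K by (simp add: kstep_def)
    qed
    have nonneg: "0 \<le> r n * kstep N False n q" if "n \<in> {1..N}" for n
      using r0(1)[OF that] by (simp add: kstep_def)
    have "0 \<le> K * real q powr (b + d - 1)" using K by simp
    from kact_le[of r "kstep N False" q, OF nonneg this le]
    show "0 \<le> kact N r (kstep N False) q
        \<and> kact N r (kstep N False) q \<le> K * C * real q powr (b + d - 1)"
      by (simp only: mult_ac simp_thms)
  qed
  then show ?thesis
    by (rule row_le_mono) (use K C_ge_1 C_le_D in \<open>auto intro: mult_left_mono\<close>)
qed

lemma D_power: "0 \<le> D ^ j"
  using D_ge_1 by simp

lemma row_le_vkern:
  assumes "row_le N (D ^ j) (real j * d - 1) r"
  shows "row_le N (D ^ (j + count_list w Ly)) (real (j + count_list w Ly) * d - 1) (kact N r (vkern N w))"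
  using assms
proof (induction w arbitrary: j r)
  case Nil
  then show ?case by (simp add: row_le_kid)
next
  case (Cons l w)
  show ?case
  proof (cases l)
    case Lx
    \<comment> \<open>The factor 1/q gained from this x is given away, so that the exponent depends
      on the letters y alone.\<close>
    have "row_le N (D ^ j) (real j * d - 1) (kact N r (kX N))"
      by (rule row_le_kX, rule row_le_mono[OF Cons.prems]) (use D_power in auto)
    from Cons.IH[OF this] show ?thesis using Lx by (simp add: kact_kmul)
  next
    case Ly
    have "row_le N (D ^ j * D) (real j * d + d - 1) (kact N r (kstep N False))"
      by (rule row_le_kstep_False[OF Cons.prems]) (use D_power d in auto)
    then have "row_le N (D ^ Suc j) (real (Suc j) * d - 1) (kact N r (kstep N False))"
      by (simp add: algebra_simps)
    from Cons.IH[OF this] show ?thesis using Ly by (simp add: kact_kmul)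
  qed
qed

lemma row_le_vkern_snoc:
  assumes "row_le N (D ^ j) (real j * d - 1) r"
  shows "row_le N (D ^ (j + count_list u Ly)) (real (j + count_list u Ly) * d - 2)
    (kact N r (vkern N (u @ [Lx])))"
proof -
  have "kact N r (vkern N (u @ [Lx])) = kact N (kact N r (vkern N u)) (kX N)"
    by (simp add: vkern_append kid_right kact_kmul)
  moreover have "row_le N (D ^ (j + count_list u Ly)) (real (j + count_list u Ly) * d - 2)
      (kact N (kact N r (vkern N u)) (kX N))"
    by (rule row_le_kX) (use row_le_vkern[OF assms, of u] in simp)
  ultimately show ?thesis by simp
qed

text \<open>Each block preserves an exponent near -2: T keeps it, the interior is run with the
  weaker exponent near -1, and the final x restores it. The bound on the total exponent supplies the
  condition of \<open>row_le_kstep_True\<close> at every block.\<close>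

lemma row_le_kprod:
  assumes "row_le N (D ^ j) (real j * d - 2) r" and "\<And>w. w \<in> set ws \<Longrightarrow> adm_word w"
    and "real (j + count_list (concat ws) Ly) * d \<le> 1"
  shows "row_le N (D ^ (j + count_list (concat ws) Ly)) (real (j + count_list (concat ws) Ly) * d - 2)
    (kact N r (kprod N (map (wkern N) ws)))"
  using assms
proof (induction ws arbitrary: j r)
  case Nil
  then show ?case by (simp add: row_le_kid)
next
  case (Cons w ws)
  let ?r = "kact N r (kstep N True)"
  obtain v where v: "w = Ly # v" using Cons.prems(2)[of w] by (auto simp: adm_word_def)
  have "real (Suc j) * d \<le> real (j + count_list (concat (w # ws)) Ly) * d"
    using d v by (intro mult_right_mono) auto
  with Cons.prems(3) have "real j * d + d \<le> 1" by (simp add: algebra_simps)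
  then have "row_le N (D ^ j * D) (real j * d + d - 2) ?r"
    by (intro row_le_kstep_True[OF Cons.prems(1)]) (use D_power in auto)
  then have r: "row_le N (D ^ Suc j) (real (Suc j) * d - 2) ?r"
    by (simp add: algebra_simps)
  have r1: "row_le N (D ^ Suc j) (real (Suc j) * d - 1) ?r"
    by (rule row_le_mono[OF r]) (use D_power[of "Suc j"] in auto)
  have v': "row_le N (D ^ (Suc j + count_list v Ly)) (real (Suc j + count_list v Ly) * d - 2)
      (kact N ?r (vkern N v))"
  proof (cases "w = [Ly]")
    case True
    with v r show ?thesis by (simp add: row_le_kid)
  next
    case False
    then obtain u where "v = u @ [Lx]" using Cons.prems(2)[of w] v by (auto simp: adm_word_def)
    with row_le_vkern_snoc[OF r1, of u] show ?thesis by simp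
  qed
  have eq: "j + count_list (concat (w # ws)) Ly = Suc j + count_list v Ly + count_list (concat ws) Ly"
    by (simp add: v)
  have k: "kact N r (kprod N (map (wkern N) (w # ws)))
      = kact N (kact N ?r (vkern N v)) (kprod N (map (wkern N) ws))"
    by (simp add: v wkern_def kact_kmul)
  show ?case
    unfolding eq k using Cons.prems by (intro Cons.IH[OF v']) (auto simp only: eq[symmetric] list.set_intros)
qed

text \<open>Here \<open>v\<close> is the rest of a block whose head has already acted. While
  \<open>v\<close> is empty the row keeps its harmonic bound and the next block is opened; at the
  first nonempty \<open>v\<close> the final x brings the exponent near -2 and
  \<open>row_le_kprod\<close> takes over. A block other than y guarantees that this happens.\<close>

lemma row_harm_vkern_kprod:
  assumes "row_harm N p (D ^ j) r"
    and "adm_word (Ly # v)" and "\<And>w. w \<in> set ws \<Longrightarrow> adm_word w"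
    and "v \<noteq> [] \<or> (\<exists>w\<in>set ws. w \<noteq> [Ly])"
    and "real (j + count_list (v @ concat ws) Ly) * d \<le> 1"
  shows "row_le N (D ^ (j + count_list (v @ concat ws) Ly))
    (real (j + count_list (v @ concat ws) Ly) * d - 2)
    (kact N r (kmul N (vkern N v) (kprod N (map (wkern N) ws))))"
  using assms
proof (induction ws arbitrary: j r v)
  case Nil
  then obtain u where u: "v = u @ [Lx]" by (auto simp: adm_word_def)
  have "row_le N (D ^ j) (real j * d - 1) r"
    by (rule row_le_mono[OF row_harm_imp_row_le[OF Nil.prems(1)]]) (use D_power d in auto)
  from row_le_vkern_snoc[OF this, of u] show ?case by (simp add: u kid_right)
next
  case (Cons w ws)
  show ?case
  proof (cases "v = []")
    case True
    obtain v' where v': "w = Ly # v'" using Cons.prems(3)[of w] by (auto simp: adm_word_def)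
    have ex: "v' \<noteq> [] \<or> (\<exists>w\<in>set ws. w \<noteq> [Ly])" using Cons.prems(4) True v' by auto
    have r: "row_harm N p (D ^ Suc j) (kact N r (kstep N True))"
      using row_harm_kstep_True[OF Cons.prems(1)] D_power by (simp add: mult.commute)
    have k: "kact N r (kmul N (vkern N v) (kprod N (map (wkern N) (w # ws))))
        = kact N (kact N r (kstep N True)) (kmul N (vkern N v') (kprod N (map (wkern N) ws)))"
    proof -
      have "kmul N (kid N) (kprod N (map (wkern N) (w # ws))) = kprod N (map (wkern N) (w # ws))"
        by (rule kid_left, rule ksupp_kprod) auto
      then show ?thesis unfolding True vkern_Nil by (simp add: v' wkern_def kact_kmul)
    qed
    have eq: "j + count_list (v @ concat (w # ws)) Ly = Suc j + count_list (v' @ concat ws) Ly"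
      by (simp add: True v')
    show ?thesis
      unfolding k eq using Cons.prems(3)[of w] v'
      by (intro Cons.IH[OF r _ _ ex])
        (use Cons.prems(3) Cons.prems(5) in \<open>auto simp only: eq[symmetric] list.set_intros\<close>)
  next
    case False
    then obtain u where u: "v = u @ [Lx]" using Cons.prems(2) by (auto simp: adm_word_def)
    have eq: "j + count_list (v @ concat (w # ws)) Ly = j + count_list u Ly + count_list (concat (w # ws)) Ly"
      by (simp add: u)
    have "row_le N (D ^ j) (real j * d - 1) r"
      by (rule row_le_mono[OF row_harm_imp_row_le[OF Cons.prems(1)]]) (use D_power d in auto)
    from row_le_vkern_snoc[OF this, of u]
    have v: "row_le N (D ^ (j + count_list u Ly)) (real (j + count_list u Ly) * d - 2) (kact N r (vkern N v))"
      by (simp add: u)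
    show ?thesis
      unfolding kact_kmul eq
      by (rule row_le_kprod[OF v]) (use Cons.prems(3) Cons.prems(5) in \<open>auto simp only: eq[symmetric]\<close>)
  qed
qed

end

lemma row_bound:
  assumes "adm_word (Ly # v)" and "\<And>w. w \<in> set ws \<Longrightarrow> adm_word w"
    and "v \<noteq> [] \<or> (\<exists>w\<in>set ws. w \<noteq> [Ly])"
  obtains B where "0 \<le> B"
    and "\<And>N p q. p \<in> {1..N} \<Longrightarrow> q \<in> {1..N} \<Longrightarrow>
      kact N (kstep N True p) (kmul N (vkern N v) (kprod N (map (wkern N) ws))) q
        \<le> B * real p powr (1/4) * real q powr (1/4 - 2)"
proof -
  define m where "m = count_list (v @ concat ws) Ly"
  \<comment> \<open>Small enough that the losses of all m letters y together stay within the
    exponent 1/4, in p as well as in q.\<close>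
  define d where "d = 1 / (4 * real (Suc m))"
  have d: "0 < d" "real m * d \<le> 1/4" by (auto simp: d_def field_simps)
  define C where "C = suminf (\<lambda>n. real n powr (-1 - d))"
  have summ: "summable (\<lambda>n. real n powr (-1 - d))" using d by (simp add: summable_real_powr_iff)
  have C: "(\<Sum>n=1..M. real n powr (-1 - d)) \<le> C" for M
    unfolding C_def by (rule sum_le_suminf[OF summ]) auto
  have C1: "1 \<le> C" using C[of 1] by simp
  show thesis
  proof (rule that[of "C ^ m"])
    show "0 \<le> C ^ m" using C1 by simp
    fix N p q :: nat assume pq: "p \<in> {1..N}" "q \<in> {1..N}"
    have p: "1 \<le> p" "p \<le> N" using pq by auto
    let ?D = "C * real p powr d"
    have "row_harm N p (?D ^ 0) (kstep N True p)" using pq by (auto simp: row_harm_def kstep_def)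
    from row_harm_vkern_kprod[OF p d(1) C this assms] d(2)
    have "row_le N (?D ^ m) (real m * d - 2)
        (kact N (kstep N True p) (kmul N (vkern N v) (kprod N (map (wkern N) ws))))"
      by (simp add: m_def)
    with pq have "kact N (kstep N True p) (kmul N (vkern N v) (kprod N (map (wkern N) ws))) q
        \<le> ?D ^ m * real q powr (real m * d - 2)"
      by (auto simp: row_le_def)
    also have "?D ^ m = C ^ m * real p powr (real m * d)"
      using p by (simp add: power_mult_distrib powr_realpow[symmetric] powr_powr mult.commute)
    also have "C ^ m * real p powr (real m * d) * real q powr (real m * d - 2)
        \<le> C ^ m * real p powr (1/4) * real q powr (1/4 - 2)"
      using d C1 pq by (intro mult_mono powr_mono) auto
    finally show "kact N (kstep N True p) (kmul N (vkern N v) (kprod N (map (wkern N) ws))) q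
        \<le> C ^ m * real p powr (1/4) * real q powr (1/4 - 2)" .
  qed
qed

text \<open>On the diagonal p = q the two powers in \<open>row_bound\<close> combine to p^(-3/2),
  which is summable.\<close>

lemma cyc_trace_bounded:
  assumes "\<And>w. w \<in> set ws \<Longrightarrow> adm_word w" and "\<exists>w\<in>set ws. w \<noteq> [Ly]"
  obtains B where "\<And>N. cyc_trace N ws \<le> B"
proof -
  obtain w ws' where ws: "ws = w # ws'" using assms(2) by (cases ws) auto
  obtain v where v: "w = Ly # v" using assms(1)[of w] by (auto simp: ws adm_word_def)
  have *: "adm_word (Ly # v)" "v \<noteq> [] \<or> (\<exists>w\<in>set ws'. w \<noteq> [Ly])"
    using assms ws v by auto
  have adm': "\<And>w. w \<in> set ws' \<Longrightarrow> adm_word w" using assms(1) ws by simp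
  obtain B where B: "0 \<le> B" "\<And>N p q. p \<in> {1..N} \<Longrightarrow> q \<in> {1..N} \<Longrightarrow>
      kact N (kstep N True p) (kmul N (vkern N v) (kprod N (map (wkern N) ws'))) q
        \<le> B * real p powr (1/4) * real q powr (1/4 - 2)"
    using row_bound[OF *(1) adm' *(2)] by blast
  have summ: "summable (\<lambda>n. real n powr (-3/2))" by (simp add: summable_real_powr_iff)
  have "cyc_trace N ws \<le> B * suminf (\<lambda>n. real n powr (-3/2))" for N
  proof -
    have "cyc_trace N ws = (\<Sum>p=1..N. kact N (kstep N True p) (kmul N (vkern N v) (kprod N (map (wkern N) ws'))) p)"
      by (simp add: cyc_trace_def ktrace_def ws v wkern_def kmul_assoc kmul_row)
    also have "\<dots> \<le> (\<Sum>p=1..N. B * real p powr (-3/2))"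
    proof (rule sum_mono)
      fix p assume p: "p \<in> {1..N}"
      have "real p powr (1/4) * real p powr (1/4 - 2) = real p powr (-3/2)"
        by (simp add: powr_add[symmetric])
      with B(2)[OF p p] show "kact N (kstep N True p) (kmul N (vkern N v) (kprod N (map (wkern N) ws'))) p
          \<le> B * real p powr (-3/2)"
        by (simp add: mult.assoc)
    qed
    also have "\<dots> \<le> B * suminf (\<lambda>n. real n powr (-3/2))"
      unfolding sum_distrib_left[symmetric]
      by (intro mult_left_mono sum_le_suminf[OF summ] B(1)) auto
    finally show ?thesis .
  qed
  then show thesis by (rule that)
qed

section \<open>The error terms vanish\<close>

lemma htail_le:
  assumes "p \<in> {1..N}"
  shows "0 \<le> htail N p" "htail N p \<le> real p / real (N + 1 - p)"
proof -
  show "0 \<le> htail N p" unfolding htail_def by (rule sum_nonneg) auto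
  have "htail N p \<le> (\<Sum>n=N-p+1..N. 1 / real (N + 1 - p))"
    unfolding htail_def by (rule sum_mono) (use assms in \<open>auto simp: frac_le\<close>)
  also have "\<dots> = real p / real (N + 1 - p)" using assms by simp
  finally show "htail N p \<le> real p / real (N + 1 - p)" .
qed

text \<open>By \<open>htail_le\<close> the summand is at most 1 / (p (N + 1 - p)) = (1/p + 1/(N + 1
  - p)) / (N + 1), and both parts sum to the harmonic number of N.\<close>

lemma sum_htail_le:
  "(\<Sum>p=1..N. htail N p * real p powr (-2)) \<le> 2 * (\<Sum>p=1..N. 1 / real p) / real (N + 1)"
proof -
  have "(\<Sum>p=1..N. htail N p * real p powr (-2))
      \<le> (\<Sum>p=1..N. (1 / real p + 1 / real (N + 1 - p)) / real (N + 1))"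
  proof (rule sum_mono)
    fix p assume p: "p \<in> {1..N}"
    have "htail N p * real p powr (-2) \<le> real p / real (N + 1 - p) * real p powr (-2)"
      using htail_le[OF p] by (intro mult_right_mono) auto
    also have "\<dots> = 1 / (real p * real (N + 1 - p))"
      using p by (simp add: powr_minus_divide power2_eq_square powr_numeral)
    also have "\<dots> = (1 / real p + 1 / real (N + 1 - p)) / real (N + 1)"
    proof -
      have "real p + real (N + 1 - p) = real (N + 1)" using p by auto
      then show ?thesis using p by (simp add: add_frac_eq add.commute del: of_nat_add)
    qed
    finally show "htail N p * real p powr (-2) \<le> (1 / real p + 1 / real (N + 1 - p)) / real (N + 1)" .
  qed
  also have "\<dots> = ((\<Sum>p=1..N. 1 / real p) + (\<Sum>p=1..N. 1 / real (N + 1 - p))) / real (N + 1)"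
    by (simp only: add_divide_distrib sum.distrib sum_divide_distrib)
  also have "(\<Sum>p=1..N. 1 / real (N + 1 - p)) = (\<Sum>p=1..N. 1 / real p)"
    by (rule sum.reindex_bij_witness[of _ "\<lambda>n. N + 1 - n" "\<lambda>n. N + 1 - n"]) auto
  finally show ?thesis by simp
qed

text \<open>The sequence \<open>harm n - ln n\<close> decreases from its value 1 at n = 1.\<close>

lemma harm_le_ln: "1 \<le> n \<Longrightarrow> (harm n :: real) \<le> ln (real n) + 1"
  using decseqD[OF decseq_harm_diff_ln, of 0 "n - 1"] by (simp add: harm_def)

text \<open>Row p of \<open>kH\<close> is \<open>htail N p\<close> times row N of T, because q \<le>
  N holds for every column. Then \<open>row_bound\<close> at row N and \<open>sum_htail_le\<close>
  give a bound of order N^(1/2) ln N / N.\<close>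

lemma cyc_error_tendsto_0:
  assumes "\<And>w. w \<in> set ws \<Longrightarrow> adm_word w" and "\<exists>w\<in>set ws. w \<noteq> [Ly]" and i: "i < length ws"
  shows "(\<lambda>N. cyc_error N ws i) \<longlonglongrightarrow> 0"
proof -
  let ?ws = "drop (Suc i) ws @ take i ws"
  have set: "set ws = insert (ws ! i) (set ?ws)"
    using i by (subst id_take_nth_drop[OF i]) auto
  obtain v where v: "ws ! i = Ly # v" using assms(1)[of "ws ! i"] i by (auto simp: adm_word_def)
  have *: "adm_word (Ly # v)" "v \<noteq> [] \<or> (\<exists>w\<in>set ?ws. w \<noteq> [Ly])"
    using assms(1)[of "ws ! i"] i assms(2) v set by auto
  have adm': "\<And>w. w \<in> set ?ws \<Longrightarrow> adm_word w" using assms(1) set by auto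
  obtain B where B: "0 \<le> B" "\<And>N p q. p \<in> {1..N} \<Longrightarrow> q \<in> {1..N} \<Longrightarrow>
      kact N (kstep N True p) (kmul N (vkern N v) (kprod N (map (wkern N) ?ws))) q
        \<le> B * real p powr (1/4) * real q powr (1/4 - 2)"
    using row_bound[OF *(1) adm' *(2)] by blast
  have kn: "0 \<le> kX N p q" "0 \<le> kstep N f p q" "0 \<le> kid N p q" for N f p q
    by (auto simp: kX_def kstep_def kid_def)
  have kprod0: "(\<And>A. A \<in> set As \<Longrightarrow> \<forall>p q. 0 \<le> A p q) \<Longrightarrow> 0 \<le> kprod N As p q" for As N p q
    by (induction As arbitrary: p) (auto simp: kn kmul_def intro!: sum_nonneg mult_nonneg_nonneg)
  have vk0: "0 \<le> vkern N w p q" for N w p q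
    unfolding vkern_def
  proof (rule kprod0)
    fix A assume "A \<in> set (map (lkern N) w)"
    then obtain l where "A = lkern N l" by auto
    then show "\<forall>p q. 0 \<le> A p q" by (cases l) (auto simp: kn)
  qed
  have wk0: "0 \<le> wkern N w p q" for N w p q
    by (auto simp: wkern_def kmul_def kn vk0 intro!: sum_nonneg mult_nonneg_nonneg)
  have wp0: "0 \<le> kprod N (map (wkern N) us) p q" for N us p q
    by (rule kprod0) (auto simp: wk0)
  have err: "cyc_error N ws i
      = (\<Sum>p=1..N. htail N p * kact N (kstep N True N) (kmul N (vkern N v) (kprod N (map (wkern N) ?ws))) p)" for N
  proof -
    have "kact N (kH N p) M p = htail N p * kact N (kstep N True N) M p" if "p \<in> {1..N}" for p M
      unfolding kact_def sum_distrib_left by (rule sum.cong) (use that in \<open>auto simp: kH_def kstep_def\<close>)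
    then show ?thesis unfolding cyc_error_def ktrace_def kmul_row v by simp
  qed
  have lower: "0 \<le> cyc_error N ws i" for N
    unfolding err kact_def kmul_def
    by (intro sum_nonneg mult_nonneg_nonneg kn vk0 wp0 htail_le) auto
  have upper: "cyc_error N ws i \<le> B * real N powr (1/2) * (2 * (ln (real N) + 1) / real (N + 1))" if N: "1 \<le> N" for N
  proof -
    have "cyc_error N ws i \<le> (\<Sum>p=1..N. B * real N powr (1/2) * (htail N p * real p powr (-2)))"
      unfolding err
    proof (rule sum_mono)
      fix p assume p: "p \<in> {1..N}"
      have "kact N (kstep N True N) (kmul N (vkern N v) (kprod N (map (wkern N) ?ws))) p
          \<le> B * real N powr (1/4) * real p powr (1/4 - 2)"
        using B(2)[of N N p] N p by simp
      also have "real p powr (1/4 - 2) = real p powr (1/4) * real p powr (-2)"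
        by (simp add: powr_add[symmetric])
      \<comment> \<open>Estimating p^(1/4) by N^(1/4) leaves p^(-2), the weight in
        \<open>sum_htail_le\<close>.\<close>
      also have "B * real N powr (1/4) * (real p powr (1/4) * real p powr (-2))
          \<le> B * real N powr (1/4) * (real N powr (1/4) * real p powr (-2))"
        using p B(1) by (intro mult_left_mono mult_right_mono powr_mono2) auto
      also have "\<dots> = B * real N powr (1/2) * real p powr (-2)"
        by (simp add: powr_add[symmetric])
      finally have "htail N p * kact N (kstep N True N) (kmul N (vkern N v) (kprod N (map (wkern N) ?ws))) p
          \<le> htail N p * (B * real N powr (1/2) * real p powr (-2))"
        using htail_le(1)[OF p] by (rule mult_left_mono)
      then show "htail N p * kact N (kstep N True N) (kmul N (vkern N v) (kprod N (map (wkern N) ?ws))) p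
          \<le> B * real N powr (1/2) * (htail N p * real p powr (-2))"
        by (simp add: mult_ac)
    qed
    also have "\<dots> = B * real N powr (1/2) * (\<Sum>p=1..N. htail N p * real p powr (-2))"
      by (simp only: sum_distrib_left)
    also have "\<dots> \<le> B * real N powr (1/2) * (2 * (\<Sum>p=1..N. 1 / real p) / real (N + 1))"
      using B(1) by (intro mult_left_mono sum_htail_le) auto
    also have "\<dots> \<le> B * real N powr (1/2) * (2 * (ln (real N) + 1) / real (N + 1))"
    proof -
      have "(\<Sum>p=1..N. 1 / real p) \<le> ln (real N) + 1"
        using harm_le_ln[OF N] by (simp add: harm_def divide_inverse)
      then show ?thesis using B(1) by (intro mult_left_mono divide_right_mono) auto
    qed
    finally show ?thesis .
  qed
  have lim: "(\<lambda>N. B * real N powr (1/2) * (2 * (ln (real N) + 1) / real (N + 1))) \<longlonglongrightarrow> 0"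
  proof -
    have "(\<lambda>N. real N powr (1/2) * (2 * (ln (real N) + 1) / real (N + 1))) \<longlonglongrightarrow> 0"
      by real_asymp
    from tendsto_mult_right_zero[OF this, of B] show ?thesis by (simp only: mult.assoc)
  qed
  show ?thesis
  proof (rule tendsto_sandwich[OF _ _ tendsto_const lim])
    show "\<forall>\<^sub>F N in sequentially. 0 \<le> cyc_error N ws i" using lower by simp
    show "\<forall>\<^sub>F N in sequentially. cyc_error N ws i \<le> B * real N powr (1/2) * (2 * (ln (real N) + 1) / real (N + 1))"
      using upper by (auto intro: eventually_sequentiallyI[of 1])
  qed
qed

subsection \<open>Reduction to words\<close>

lemma shuffle_word_Ly: "shuffle_word [Ly] w = mon (Ly # w) + (\<Sum>v\<leftarrow>ins w. mon v)"
proof (induction w)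
  case (Cons a w)
  have "mon [a] * (\<Sum>v\<leftarrow>ins w. mon v) = (\<Sum>v\<leftarrow>ins w. mon (a # v))"
    by (simp add: sum_list_const_mult[symmetric] mon_mult)
  then show ?case by (simp add: Cons.IH mon_mult distrib_left o_def)
qed simp

text \<open>The first and the last letter stay in place, so y may go after any letter but the last.
  For a single letter \<open>butlast w\<close> is empty and both sides are 0.\<close>

lemma inner_shuffle_word_Ly:
  assumes "w \<noteq> []"
  shows "inner_shuffle_word [Ly] w = (\<Sum>v\<leftarrow>ins (butlast w). mon (v @ [last w]))"
proof (cases "length w \<ge> 2")
  case True
  then obtain a u b where w: "w = a # u @ [b]"
    by (cases w; cases "tl w" rule: rev_cases) auto
  have "mon [a] * (\<Sum>v\<leftarrow>ins u. mon v) * mon [b] = (\<Sum>v\<leftarrow>ins u. mon (a # v @ [b]))"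
    by (simp add: sum_list_const_mult[symmetric] sum_list_mult_const[symmetric] mon_mult)
  then show ?thesis
    by (simp add: w inner_shuffle_word_def shuffle_word_Ly distrib_left distrib_right mon_mult o_def butlast_append)
next
  case False
  then obtain a where "w = [a]" using assms by (cases w; cases "tl w") auto
  then show ?thesis by (simp add: inner_shuffle_word_def)
qed

lemma inner_shuffle_add: "inner_shuffle p (q + q') = inner_shuffle p q + inner_shuffle p q'"
  by (simp add: inner_shuffle_def bilinear_ext_add_right)

lemma inner_shuffle_ncy_mon: "inner_shuffle ncy (scalar c * mon w) = scalar c * inner_shuffle_word [Ly] w"
  using bilinear_ext_mon[of inner_shuffle_word 1 "[Ly]" c w] by (simp add: inner_shuffle_def ncy_def)

lemma shuffle_ncy_mon: "shuffle ncy (scalar c * mon w) = scalar c * shuffle_word [Ly] w"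
  using bilinear_ext_mon[of shuffle_word 1 "[Ly]" c w] by (simp add: shuffle_def ncy_def)

lemma inner_shuffle_ncy_scalar: "inner_shuffle ncy (scalar c * p) = scalar c * inner_shuffle ncy p"
proof (induction p rule: ncpoly_induct)
  case (mon d w)
  have "inner_shuffle ncy (scalar (c * d) * mon w) = scalar (c * d) * inner_shuffle_word [Ly] w"
    by (rule inner_shuffle_ncy_mon)
  then show ?case by (simp add: inner_shuffle_ncy_mon mult.assoc)
qed (simp add: distrib_left inner_shuffle_add)

lemma inner_shuffle_ncy_eq_mon:
  assumes "w \<noteq> []"
  shows "inner_shuffle ncy (scalar c * mon w)
    = shuffle ncy (scalar c * mon w) - ncy * (scalar c * mon w) - scalar c * mon w * ncy"
proof -
  obtain w0 l where w: "w = w0 @ [l]" using assms by (cases w rule: rev_cases) auto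
  have "(\<Sum>v\<leftarrow>ins w. mon v) = inner_shuffle_word [Ly] w + mon (w @ [Ly])"
    by (simp add: w ins_snoc inner_shuffle_word_Ly o_def)
  then have "inner_shuffle_word [Ly] w = shuffle_word [Ly] w - mon (Ly # w) - mon (w @ [Ly])"
    by (simp add: shuffle_word_Ly)
  then show ?thesis
    unfolding inner_shuffle_ncy_mon shuffle_ncy_mon
    by (simp add: ncy_def scalar_mon_mult mon_mult right_diff_distrib mult.assoc)
qed

lemma inner_shuffle_ncy_eq:
  assumes "u \<in> hC"
  shows "inner_shuffle ncy u = shuffle ncy u - ncy * u - u * ncy"
proof -
  let ?P = "\<lambda>u. inner_shuffle ncy u = shuffle ncy u - ncy * u - u * ncy"
  have P_add: "?P (p + q)" if "?P p" "?P q" for p q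
  proof -
    have "shuffle ncy (p + q) = shuffle ncy p + shuffle ncy q"
      by (simp add: shuffle_def bilinear_ext_add_right)
    then show ?thesis unfolding inner_shuffle_add that by (simp add: algebra_simps)
  qed
  \<comment> \<open>Elements of \<open>hC\<close> are sums of products \<open>a * mon [l]\<close>,
    so only nonempty words occur; for the empty word the formula would fail.\<close>
  have snoc: "?P (a * mon [l])" for a l
  proof (induction a rule: ncpoly_induct)
    case (mon c w)
    have "scalar c * mon w * mon [l] = scalar c * mon (w @ [l])" by (simp add: mult.assoc mon_mult)
    then show ?case using inner_shuffle_ncy_eq_mon[of "w @ [l]" c] by simp
  next
    case (add p q)
    from P_add[OF this] show ?case by (simp only: distrib_right[of p q "mon [l]"])
  qed
  obtain a b where "u = a * ncx + b * ncy" using assms by (auto simp: hC_def)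
  then show ?thesis using P_add[OF snoc snoc] by (simp add: ncx_def ncy_def)
qed

lemma keys_mon_mult_mon:
  assumes "w \<in> Poly_Mapping.keys (mon s * a * mon t)"
  shows "\<exists>v. letters w = s @ v @ t"
  using assms
proof (induction a rule: ncpoly_induct)
  case (mon c v)
  have "mon s * (scalar c * mon v) * mon t = Poly_Mapping.single (Word (s @ v @ t)) c"
    by (simp add: scalar_mon_mult mult.assoc mon_mult single_eq_scalar_mon)
  with mon show ?case by (auto split: if_splits)
next
  case (add p q)
  then show ?case using Poly_Mapping.keys_add[of "mon s * p * mon t" "mon s * q * mon t"]
    by (auto simp: distrib_left distrib_right)
qed

text \<open>Membership in \<open>h0\<close> yields words y...x and a constant; comparing
  coefficients at the empty word, membership in \<open>hC\<close> makes the constant 0.\<close>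

lemma keys_hC0:
  assumes "u \<in> hC0" "w \<in> Poly_Mapping.keys u"
  shows "\<exists>v. letters w = Ly # v @ [Lx]"
proof -
  obtain c a where u: "u = scalar c + ncy * a * ncx" using assms by (auto simp: hC0_def h0_def)
  obtain b b' where u': "u = b * ncx + b' * ncy" using assms by (auto simp: hC0_def hC_def)
  have k: "0 \<notin> Poly_Mapping.keys (mon s * p * mon t)" if "s @ t \<noteq> []" for s t p
    using keys_mon_mult_mon[of 0 s p t] that by (auto simp: zero_ncword_def)
  have "Poly_Mapping.lookup (b * ncx) 0 = 0" "Poly_Mapping.lookup (b' * ncy) 0 = 0"
    "Poly_Mapping.lookup (ncy * a * ncx) 0 = 0"
    using k[of "[]" "[Lx]" b] k[of "[]" "[Ly]" b'] k[of "[Ly]" "[Lx]" a]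
    by (simp_all add: mon_Nil ncx_def ncy_def in_keys_iff)
  then have "Poly_Mapping.lookup (scalar c) 0 = 0" using u u' by (metis add.right_neutral lookup_add)
  then have "c = 0" by (simp add: scalar_def)
  then show ?thesis using assms(2) u keys_mon_mult_mon[of w "[Ly]" a "[Lx]"] by (simp add: ncx_def ncy_def)
qed

section \<open>Multilinear reduction to words\<close>

definition rat_linear :: "(ncpoly \<Rightarrow> real) \<Rightarrow> bool" where
  "rat_linear f \<longleftrightarrow> (\<forall>p q. f (p + q) = f p + f q) \<and> (\<forall>c p. f (scalar c * p) = of_rat c * f p)"

lemma rat_linear_expand:
  assumes "rat_linear f"
  shows "f u = (\<Sum>w\<in>Poly_Mapping.keys u. of_rat (Poly_Mapping.lookup u w) * f (mon (letters w)))"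
proof -
  have "f (scalar 0 * 0) = 0" using assms unfolding rat_linear_def by (metis mult_zero_left of_rat_0)
  then have zero: "f 0 = 0" by simp
  have "f (\<Sum>w\<in>A. Poly_Mapping.single w (Poly_Mapping.lookup u w))
      = (\<Sum>w\<in>A. of_rat (Poly_Mapping.lookup u w) * f (mon (letters w)))" if "finite A" for A
    using that by induction (use assms zero in \<open>simp_all add: rat_linear_def single_eq_scalar_mon\<close>)
  moreover have "(\<Sum>w\<in>Poly_Mapping.keys u. Poly_Mapping.single w (Poly_Mapping.lookup u w)) = u"
    by (rule poly_mapping_eqI) (simp add: lookup_sum lookup_single when_def in_keys_iff)
  ultimately show ?thesis by (metis finite_keys)
qed

lemma rat_linear_diff: "rat_linear f \<Longrightarrow> rat_linear g \<Longrightarrow> rat_linear (\<lambda>u. f u - g u)"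
  by (simp add: rat_linear_def algebra_simps)

lemma rat_linear_sum: "(\<And>i. i \<in> S \<Longrightarrow> rat_linear (f i)) \<Longrightarrow> rat_linear (\<lambda>u. \<Sum>i\<in>S. f i u)"
  by (simp add: rat_linear_def sum.distrib sum_distrib_left)

text \<open>Expands one slot at a time into words. Testing only words from the supports of the given
  factors carries the restriction to \<open>hC0\<close> and \<open>ncy\<close> over to
  words.\<close>

lemma multilinear_eq_0:
  fixes \<Phi> :: "ncpoly list \<Rightarrow> real"
  assumes lin: "\<And>us j. j < length us \<Longrightarrow> rat_linear (\<lambda>u. \<Phi> (us[j := u]))"
    and "\<And>ws. list_all2 (\<lambda>w u. Word w \<in> Poly_Mapping.keys u) ws us \<Longrightarrow> \<Phi> (map mon ws) = 0"
  shows "\<Phi> us = 0"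
proof -
  \<comment> \<open>\<open>pre\<close> holds the slots already replaced by words; the induction on
    the remaining slots is generalized over it.\<close>
  have "\<Phi> (map mon pre @ us) = 0"
    if "\<And>ws. list_all2 (\<lambda>w u. Word w \<in> Poly_Mapping.keys u) ws us \<Longrightarrow> \<Phi> (map mon (pre @ ws)) = 0" for pre
    using that
  proof (induction us arbitrary: pre)
    case Nil
    then show ?case by simp
  next
    case (Cons u us)
    have "rat_linear (\<lambda>v. \<Phi> (map mon pre @ v # us))"
      using lin[of "length pre" "map mon pre @ u # us"] by (simp add: list_update_append)
    from rat_linear_expand[OF this, of u]
    have "\<Phi> (map mon pre @ u # us) = (\<Sum>w\<in>Poly_Mapping.keys u.
        of_rat (Poly_Mapping.lookup u w) * \<Phi> (map mon (pre @ [letters w]) @ us))"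
      by simp
    also have "\<dots> = 0"
    proof (rule sum.neutral, rule ballI)
      fix w assume w: "w \<in> Poly_Mapping.keys u"
      have "\<Phi> (map mon (pre @ [letters w]) @ us) = 0"
      proof (rule Cons.IH)
        fix ws assume "list_all2 (\<lambda>w u. Word w \<in> Poly_Mapping.keys u) ws us"
        then show "\<Phi> (map mon ((pre @ [letters w]) @ ws)) = 0"
          using Cons.prems[of "letters w # ws"] w by simp
      qed
      then show "of_rat (Poly_Mapping.lookup u w) * \<Phi> (map mon (pre @ [letters w]) @ us) = 0" by simp
    qed
    finally show ?case .
  qed
  from this[of "[]"] assms(2) show ?thesis by simp
qed

lemma lookup_scalar_mult: "Poly_Mapping.lookup (scalar c * p) w = c * Poly_Mapping.lookup p w"
proof (induction p rule: ncpoly_induct)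
  case (mon d v)
  have "scalar c * (scalar d * mon v) = Poly_Mapping.single (Word v) (c * d)"
    and "scalar d * mon v = Poly_Mapping.single (Word v) d"
    by (simp_all add: single_eq_scalar_mon mult.assoc)
  then show ?case by (simp add: lookup_single when_def)
qed (simp add: distrib_left lookup_add)

lemma lookup_tensor_update:
  assumes "j < length us"
  shows "Poly_Mapping.lookup (tensor (us[j := u])) ws = (if length ws = length us
    then Poly_Mapping.lookup u (ws ! j) * (\<Prod>i\<in>{..<length us} - {j}. Poly_Mapping.lookup (us ! i) (ws ! i))
    else 0)"
proof -
  have "(\<Prod>i<length us. Poly_Mapping.lookup (us[j := u] ! i) (ws ! i))
     = Poly_Mapping.lookup (us[j := u] ! j) (ws ! j)
       * (\<Prod>i\<in>{..<length us} - {j}. Poly_Mapping.lookup (us[j := u] ! i) (ws ! i))"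
    using assms by (intro prod.remove) auto
  also have "\<dots> = Poly_Mapping.lookup u (ws ! j)
       * (\<Prod>i\<in>{..<length us} - {j}. Poly_Mapping.lookup (us ! i) (ws ! i))"
    using assms by (intro arg_cong2[of _ _ _ _ "(*)"] prod.cong) auto
  finally show ?thesis by (simp add: lookup_tensor)
qed

lemma Z_cyc_scale:
  assumes "\<And>ws. Poly_Mapping.lookup T' ws = c * Poly_Mapping.lookup T ws"
  shows "Z_cyc T' = of_rat c * Z_cyc T"
proof -
  \<comment> \<open>Summed over the keys of \<open>T\<close>, because for c = 0 the tensor
    \<open>T'\<close> has no keys.\<close>
  have "Z_cyc T' = (\<Sum>ws\<in>Poly_Mapping.keys T.
      of_rat (Poly_Mapping.lookup T' ws) * zeta_cyc (map (\<lambda>w. zindex (letters w)) ws))"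
    unfolding Z_cyc_def by (rule sum.mono_neutral_left) (auto simp: in_keys_iff assms)
  then show ?thesis by (simp add: Z_cyc_def assms of_rat_mult sum_distrib_left mult.assoc)
qed

lemma rat_linear_Z_cyc:
  assumes "j < length us"
  shows "rat_linear (\<lambda>u. Z_cyc (tensor (us[j := u])))"
  unfolding rat_linear_def
proof (intro conjI allI)
  fix p q
  have "tensor (us[j := p + q]) = tensor (us[j := p]) + tensor (us[j := q])"
    by (rule poly_mapping_eqI) (simp add: lookup_add lookup_tensor_update assms distrib_right)
  then show "Z_cyc (tensor (us[j := p + q])) = Z_cyc (tensor (us[j := p])) + Z_cyc (tensor (us[j := q]))"
    by (simp add: Z_cyc_add)
next
  fix c p
  show "Z_cyc (tensor (us[j := scalar c * p])) = of_rat c * Z_cyc (tensor (us[j := p]))"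
    by (rule Z_cyc_scale) (simp add: lookup_tensor_update assms lookup_scalar_mult)
qed

lemma rat_linear_inner_shuffle:
  assumes "rat_linear f"
  shows "rat_linear (\<lambda>u. f (inner_shuffle ncy u))"
  using assms by (simp add: rat_linear_def inner_shuffle_add inner_shuffle_ncy_scalar)

text \<open>The difference of the two sides of the theorem, taken as one functional that is linear
  in each factor.\<close>

definition cyc_defect :: "ncpoly list \<Rightarrow> real" where
  "cyc_defect us = (\<Sum>i<length us. Z_cyc (tensor (us[i := inner_shuffle ncy (us ! i)])))
     - (\<Sum>i<length us. Z_cyc (tensor (take (Suc i) us @ [ncy] @ drop (Suc i) us)))"

lemma rat_linear_cyc_defect:
  assumes j: "j < length us"
  shows "rat_linear (\<lambda>u. cyc_defect (us[j := u]))"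
  unfolding cyc_defect_def length_list_update
proof (intro rat_linear_diff rat_linear_sum)
  fix i assume "i \<in> {..<length us}"
  then have i: "i < length us" by simp
  show "rat_linear (\<lambda>u. Z_cyc (tensor (us[j := u, i := inner_shuffle ncy (us[j := u] ! i)])))"
  proof (cases "i = j")
    case True
    then show ?thesis using rat_linear_inner_shuffle[OF rat_linear_Z_cyc[OF j]] j by simp
  next
    case False
    then have "us[j := u, i := inner_shuffle ncy (us[j := u] ! i)] = us[i := inner_shuffle ncy (us ! i), j := u]" for u
      by (simp add: list_update_swap)
    then show ?thesis using rat_linear_Z_cyc[of j "us[i := inner_shuffle ncy (us ! i)]"] j by simp
  qed
  \<comment> \<open>Position of slot j once y has been inserted behind slot i.\<close>
  define j' where "j' = (if j < Suc i then j else Suc j)"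
  let ?vs = "take (Suc i) us @ [ncy] @ drop (Suc i) us"
  have "take (Suc i) (us[j := u]) @ [ncy] @ drop (Suc i) (us[j := u]) = ?vs[j' := u]" for u
  proof (cases "j < Suc i")
    case True
    then show ?thesis using i by (simp add: j'_def take_update_swap drop_update_cancel list_update_append)
  next
    case False
    then obtain k where "j = Suc i + k" using le_Suc_ex[of "Suc i" j] by auto
    then show ?thesis using i by (simp add: j'_def drop_update_swap list_update_append)
  qed
  moreover have "j' < length ?vs" using i j by (auto simp: j'_def)
  ultimately show "rat_linear (\<lambda>u. Z_cyc (tensor (take (Suc i) (us[j := u]) @ [ncy] @ drop (Suc i) (us[j := u]))))"
    using rat_linear_Z_cyc[of j' ?vs] by simp
qed

lemma Z_cyc_tensor_mon: "Z_cyc (tensor (map mon ws)) = zeta_cyc (map zindex ws)"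
  by (simp add: tensor_mon Z_cyc_def o_def)

lemma Z_cyc_inner_shuffle_mon:
  assumes "i < length ws" "ws ! i \<noteq> []"
  shows "Z_cyc (tensor ((map mon ws)[i := inner_shuffle ncy (map mon ws ! i)]))
    = (\<Sum>v\<leftarrow>ins (butlast (ws ! i)). zeta_cyc (map zindex (ws[i := v @ [last (ws ! i)]])))"
proof -
  have lin: "rat_linear (\<lambda>u. Z_cyc (tensor ((map mon ws)[i := u])))"
    by (rule rat_linear_Z_cyc) (use assms in simp)
  then have zero: "Z_cyc (tensor ((map mon ws)[i := 0])) = 0"
    unfolding rat_linear_def by (metis mult_zero_left of_rat_0 scalar_simps(1))
  have "inner_shuffle ncy (map mon ws ! i) = (\<Sum>v\<leftarrow>ins (butlast (ws ! i)). mon (v @ [last (ws ! i)]))"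
    using inner_shuffle_ncy_mon[of 1 "ws ! i"] assms by (simp add: inner_shuffle_word_Ly)
  moreover have "Z_cyc (tensor ((map mon ws)[i := (\<Sum>v\<leftarrow>vs. mon (g v))]))
      = (\<Sum>v\<leftarrow>vs. zeta_cyc (map zindex (ws[i := g v])))" for vs and g :: "letter list \<Rightarrow> letter list"
  proof (induction vs)
    case (Cons v vs)
    have "(map mon ws)[i := mon (g v)] = map mon (ws[i := g v])" by (simp add: map_update)
    then have "Z_cyc (tensor ((map mon ws)[i := mon (g v)])) = zeta_cyc (map zindex (ws[i := g v]))"
      by (simp only: Z_cyc_tensor_mon)
    with Cons lin show ?case by (simp add: rat_linear_def)
  qed (simp add: zero)
  ultimately show ?thesis by simp
qed

text \<open>\<open>zindex\<close> forgets leading letters x, so on words that start with y it is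
  inverted by \<open>zword\<close>.\<close>

lemma zword_zindex: "zword (zindex w) = dropWhile (\<lambda>a. a = Lx) w"
proof (induction w rule: zindex.induct)
  case (3 w)
  have "takeWhile (\<lambda>a. a = Lx) w = replicate (length (takeWhile (\<lambda>a. a = Lx) w)) Lx"
    by (rule replicate_eqI) (auto dest: set_takeWhileD)
  moreover have "zword (zindex (dropWhile (\<lambda>a. a = Lx) w)) = dropWhile (\<lambda>a. a = Lx) w"
    using 3 by (simp add: dropWhile_idem)
  ultimately show ?case
    by (simp add: zword_Cons)
qed (simp_all add: zword_def)

lemma zindex_pos: "k \<in> set (zindex w) \<Longrightarrow> 1 \<le> k"
  by (induction w rule: zindex.induct) auto

section \<open>Passage to the limit and the theorem\<close>

lemma cyc_trace_tendsto:
  assumes "\<And>w. w \<in> set ws \<Longrightarrow> adm_word w" "\<exists>w\<in>set ws. w \<noteq> [Ly]"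
  shows "(\<lambda>N. cyc_trace N ws) \<longlonglongrightarrow> zeta_cyc (map zindex ws)"
proof -
  let ?kk = "map zindex ws"
  have Ly: "\<exists>v. w = Ly # v" if "w \<in> set ws" for w
    using assms(1)[OF that] by (auto simp: adm_word_def)
  have "zword (zindex w) = w" if "w \<in> set ws" for w
    using Ly[OF that] by (auto simp: zword_zindex)
  then have ws: "map zword ?kk = ws" by (simp add: map_idI)
  have "pos_indices ?kk" unfolding pos_indices_def using Ly zindex_pos by fastforce
  moreover have "?kk \<noteq> []" using assms(2) by auto
  moreover obtain B where "\<And>N. cyc_trace N ws \<le> B" using cyc_trace_bounded[OF assms] by blast
  ultimately show ?thesis using cyc_trace_tendsto_zeta_cyc[of ?kk B] unfolding ws by blast
qed

lemma tendsto_sum_list: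
  fixes f :: "'a \<Rightarrow> 'b \<Rightarrow> real"
  assumes "\<And>x. x \<in> set xs \<Longrightarrow> (f x \<longlongrightarrow> L x) F"
  shows "((\<lambda>n. \<Sum>x\<leftarrow>xs. f x n) \<longlongrightarrow> (\<Sum>x\<leftarrow>xs. L x)) F"
  using assms by (induction xs) (auto intro!: tendsto_add)

lemma adm_word_ins:
  assumes "adm_word w" "v \<in> set (ins (butlast w))"
  shows "adm_word (v @ [last w])" "v @ [last w] \<noteq> [Ly]"
proof -
  \<comment> \<open>The case w = y cannot occur: \<open>butlast w\<close> is then empty and has no
    insertions.\<close>
  obtain u where u: "w = Ly # u @ [Lx]" using assms by (auto simp: adm_word_def)
  then have "\<exists>v'. v = Ly # v'" using assms(2) by (auto simp: butlast_append)
  then show "adm_word (v @ [last w])" "v @ [last w] \<noteq> [Ly]" using u by (auto simp: adm_word_def)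
qed

text \<open>The limit of \<open>cyc_trace_identity\<close>: every trace tends to its cyclic zeta
  value and the errors tend to 0.\<close>

lemma zeta_cyc_word_identity:
  assumes adm: "\<And>w. w \<in> set ws \<Longrightarrow> adm_word w" and ex: "\<exists>w\<in>set ws. w \<noteq> [Ly]"
  shows "(\<Sum>i<length ws. \<Sum>v\<leftarrow>ins (butlast (ws ! i)). zeta_cyc (map zindex (ws[i := v @ [last (ws ! i)]])))
       = (\<Sum>i<length ws. zeta_cyc (map zindex (take (Suc i) ws @ [[Ly]] @ drop (Suc i) ws)))" (is "?L = ?R")
proof -
  let ?l = "\<lambda>N. \<Sum>i<length ws. \<Sum>v\<leftarrow>ins (butlast (ws ! i)). cyc_trace N (ws[i := v @ [last (ws ! i)]])"
  have L: "?l \<longlonglongrightarrow> ?L"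
  proof (intro tendsto_sum tendsto_sum_list cyc_trace_tendsto)
    fix i v assume i: "i \<in> {..<length ws}" and v: "v \<in> set (ins (butlast (ws ! i)))"
    have a: "adm_word (v @ [last (ws ! i)])" "v @ [last (ws ! i)] \<noteq> [Ly]"
      using adm_word_ins[OF adm v] i by auto
    show "adm_word w" if "w \<in> set (ws[i := v @ [last (ws ! i)]])" for w
      using that a adm set_update_subset_insert[of ws i] by blast
    show "\<exists>w\<in>set (ws[i := v @ [last (ws ! i)]]). w \<noteq> [Ly]"
      using a(2) i by (auto intro!: bexI[OF _ set_update_memI])
  qed
  have R: "(\<lambda>N. \<Sum>i<length ws. cyc_trace N (take (Suc i) ws @ [[Ly]] @ drop (Suc i) ws)) \<longlonglongrightarrow> ?R"
  proof (intro tendsto_sum cyc_trace_tendsto)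
    fix i
    have set: "set (take (Suc i) ws @ [[Ly]] @ drop (Suc i) ws) = insert [Ly] (set ws)"
      by (metis append_take_drop_id insert_is_Un list.set(1) list.set(2) set_append sup_left_commute)
    show "adm_word w" if "w \<in> set (take (Suc i) ws @ [[Ly]] @ drop (Suc i) ws)" for w
      using that adm unfolding set by (auto simp: adm_word_def)
    show "\<exists>w\<in>set (take (Suc i) ws @ [[Ly]] @ drop (Suc i) ws). w \<noteq> [Ly]"
      using ex unfolding set by blast
  qed
  have E: "(\<lambda>N. \<Sum>i<length ws. cyc_error N ws i) \<longlonglongrightarrow> (\<Sum>i<length ws. 0)"
    by (intro tendsto_sum cyc_error_tendsto_0[OF adm ex]) auto
  have "\<exists>w'. w = Ly # w'" if "w \<in> set ws" for w
    using adm[OF that] by (auto simp: adm_word_def)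
  then have eq: "?l N = (\<Sum>i<length ws. cyc_trace N (take (Suc i) ws @ [[Ly]] @ drop (Suc i) ws))
      - (\<Sum>i<length ws. cyc_error N ws i)" for N
    by (rule cyc_trace_identity)
  have "?l \<longlonglongrightarrow> ?R - (\<Sum>i<length ws. 0)"
    unfolding eq by (rule tendsto_diff[OF R E])
  with L have "?L = ?R - (\<Sum>i<length ws. 0)" by (rule LIMSEQ_unique)
  then show ?thesis by simp
qed

lemma cyc_defect_mon:
  assumes adm: "\<And>w. w \<in> set ws \<Longrightarrow> adm_word w" and ex: "\<exists>w\<in>set ws. w \<noteq> [Ly]"
  shows "cyc_defect (map mon ws) = 0"
proof -
  have "(\<Sum>i<length ws. Z_cyc (tensor ((map mon ws)[i := inner_shuffle ncy (map mon ws ! i)])))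
      = (\<Sum>i<length ws. \<Sum>v\<leftarrow>ins (butlast (ws ! i)). zeta_cyc (map zindex (ws[i := v @ [last (ws ! i)]])))"
  proof (rule sum.cong[OF refl], rule Z_cyc_inner_shuffle_mon)
    fix i assume "i \<in> {..<length ws}"
    then show "i < length ws" "ws ! i \<noteq> []" using adm[of "ws ! i"] by (auto simp: adm_word_def)
  qed
  moreover have "Z_cyc (tensor (take (Suc i) (map mon ws) @ [ncy] @ drop (Suc i) (map mon ws)))
      = zeta_cyc (map zindex (take (Suc i) ws @ [[Ly]] @ drop (Suc i) ws))" for i
    using Z_cyc_tensor_mon[of "take (Suc i) ws @ [[Ly]] @ drop (Suc i) ws"]
    by (simp add: ncy_def take_map drop_map)
  ultimately show ?thesis
    unfolding cyc_defect_def length_map by (simp only: zeta_cyc_word_identity[OF assms])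
qed

theorem theorem1p2:
  fixes us :: "ncpoly list"
  assumes "length us \<ge> 1"
    and "\<forall>i<length us. us ! i \<in> hC0 \<union> {ncy}"
    and "\<exists>j<length us. us ! j \<noteq> ncy"
  shows "(\<Sum>i<length us. Z_cyc (tensor (us[i := inner_shuffle ncy (us ! i)])))
       = (\<Sum>i<length us. Z_cyc (tensor (take (Suc i) us @ [ncy] @ drop (Suc i) us)))
     \<and> (\<forall>i<length us. inner_shuffle ncy (us ! i)
            = shuffle ncy (us ! i) - ncy * us ! i - us ! i * ncy)"
proof
  have "cyc_defect us = 0"
  proof (rule multilinear_eq_0)
    fix ws assume ws: "list_all2 (\<lambda>w u. Word w \<in> Poly_Mapping.keys u) ws us"
    \<comment> \<open>A factor other than y lies in \<open>hC0\<close>, so its words have the form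
      y...x; the factor y contributes only the word y.\<close>
    have word: "(\<exists>v. ws ! i = Ly # v @ [Lx]) \<or> us ! i = ncy \<and> ws ! i = [Ly]" if "i < length us" for i
    proof (cases "us ! i = ncy")
      case True
      then show ?thesis using list_all2_nthD2[OF ws that] by (simp add: ncy_def mon_def)
    next
      case False
      then show ?thesis using keys_hC0[OF _ list_all2_nthD2[OF ws that]] assms(2) that by auto
    qed
    have len: "length ws = length us" using ws by (rule list_all2_lengthD)
    show "cyc_defect (map mon ws) = 0"
    proof (rule cyc_defect_mon)
      show "adm_word w" if "w \<in> set ws" for w
        using that word len by (auto simp: in_set_conv_nth adm_word_def)
      \<comment> \<open>The factor other than y contributes only words other than y, so every choice
        of words keeps such a block.\<close>
      obtain j where "j < length us" "us ! j \<noteq> ncy" using assms(3) by blast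
      with word[of j] len have "ws ! j \<noteq> [Ly]" "ws ! j \<in> set ws" by auto
      then show "\<exists>w\<in>set ws. w \<noteq> [Ly]" by blast
    qed
  qed (rule rat_linear_cyc_defect)
  then show "(\<Sum>i<length us. Z_cyc (tensor (us[i := inner_shuffle ncy (us ! i)])))
      = (\<Sum>i<length us. Z_cyc (tensor (take (Suc i) us @ [ncy] @ drop (Suc i) us)))"
    by (simp add: cyc_defect_def)
  \<comment> \<open>\<open>inner_shuffle_ncy_eq\<close> holds on \<open>hC\<close>, which contains
    \<open>hC0\<close> and, by this decomposition, also y.\<close>
  have "ncy = 0 * ncx + 1 * ncy" by simp
  then have "ncy \<in> hC" unfolding hC_def by blast
  then show "\<forall>i<length us. inner_shuffle ncy (us ! i)
      = shuffle ncy (us ! i) - ncy * us ! i - us ! i * ncy"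
    using assms(2) inner_shuffle_ncy_eq by (auto simp: hC0_def)
qed

end
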